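(* For every real $\epsilon > 0$ there are infinitely many positive integers $n$ (large enough that the iterated logarithms below are defined and positive) such that $$f(n) \ge \left(\frac{3}{2\pi^2} - \epsilon\right)(\log n)\,\frac{(\log_{2} n)(\log_{4} n)}{(\log_{3} n)^2}.$$
   Context: For a positive integer $n$, $S(n) := \sum_{p^a \,\|\, n} a p$ is the sum of the prime factors of $n$ counted with multiplicity; here $p$ runs over primes, and $p^a \,\|\, n$ (with $a\ge 1$) means $p^a \mid n$ but $p^{a+1} \nmid n$. For a positive integer $n$, $$f(n) := \min\left\{h \ge 1 : \sum_{t=1}^{h} S(n+t) > n\right\},$$ the minimum being over positive integers $h$. Here $\log$ is the natural logarithm and $\log_j$ denotes the $j$-th iterated logarithm, $\log_1 x := \log x$, $\log_j x := \log(\log_{j-1} x)$ for $j \ge 2$, defined for sufficiently large $x$. *)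

theory Defs
  imports Complex_Main "HOL-Computational_Algebra.Primes"
begin

(* multiplicity p n is the exponent a with p^a || n *)
definition S :: "nat \<Rightarrow> nat" where
  "S n = (\<Sum>p\<in>prime_factors n. multiplicity p n * p)"

definition f :: "nat \<Rightarrow> nat" where
  "f n = (LEAST h. h \<ge> 1 \<and> (\<Sum>t=1..h. S (n + t)) > n)"

definition iter_log :: "nat \<Rightarrow> real \<Rightarrow> real" where
  "iter_log j x = (ln ^^ j) x"

lemma S_ge_1:
  assumes "n \<ge> 2"
  shows "S n \<ge> 1"
proof -
  obtain p where p: "prime p" "p dvd n"
    using prime_factor_nat[of n] assms by auto
  with assms have in_pf: "p \<in> prime_factors n"
    by (auto simp: prime_factors_dvd)
  hence "multiplicity p n * p \<ge> 1"
    using p assms by (simp add: prime_factors_multiplicity prime_gt_0_nat Suc_le_eq)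
  also have "multiplicity p n * p \<le> S n"
    unfolding S_def by (rule member_le_sum[OF in_pf]) auto
  finally show ?thesis .
qed

(* the set whose least element is f n is nonempty for n > 0 *)
lemma f_well_defined:
  assumes "n > 0"
  shows "f n \<ge> 1 \<and> (\<Sum>t=1..f n. S (n + t)) > n"
proof -
  have "(\<Sum>t=1..n + 1. 1) \<le> (\<Sum>t=1..n + 1. S (n + t))"
    using assms by (intro sum_mono S_ge_1) auto
  hence "n + 1 \<ge> 1 \<and> (\<Sum>t=1..n + 1. S (n + t)) > n"
    by simp
  thus ?thesis
    unfolding f_def by (rule LeastI)
qed

end

theory Submission
  imports Defs "HOL-Analysis.Analysis" "HOL-Number_Theory.Cong" "HOL-Real_Asymp.Real_Asymp"
begin

text \<open>
  Let $x \to \infty$, let $Q$ be the product of the primes in $(z, x]$, where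
  $\log z = \log x \log_3 x / (b \log_2 x)$ with $b > 2$ close to $2$, and average
  $\sum_{t \le h} S(kQ + t)$ over $k$ in an interval starting at $A$ with $\log A \sim x \log_2 x$.
  A large value of $S(v)$ comes from $v = mq$ with $q$ prime and $m$ small; for fixed $t$ the
  number of such $k$ is bounded by Brun--Titchmarsh, and summing over $m$ costs
  $\sum m^{-2} = \pi^2/6$. With $d = \gcd(t, Q)$ the average of $S(kQ + t)$ is thus at most about
  $\frac{AQ}{d} \cdot \frac{\pi^2}{6} \cdot \frac{Q}{\varphi(Q)} \cdot \frac{2}{\log A}$, where
  $Q / \varphi(Q) \sim \log x / \log z$.

  The gain is in $\sum_{t \le h} 1/d$: a number $t \le h$ with $d = 1$ either has a prime factor
  in $(x, h]$, which by Mertens happens for about $h \log_2 x / \log x$ numbers, or is $z$-smooth,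
  and by Rankin's trick there are fewer of these as soon as $b > 2$. For
  $h = c\,x \log x \log_3 x / \log_2 x$ the average of the whole sum is therefore about
  $c\, b\, \frac{\pi^2}{3} AQ$, which is below $AQ$ if $c < 3 / (b \pi^2)$; some multiple $n = kQ$
  then satisfies $f(n) > h$.
\<close>

section \<open>Mertens estimates\<close>

text \<open>The two cut-offs balance each other. Leaving the primes up to z out of Q lowers Q/phi(Q)
  from order log x to log x / log z = b log_2 x / log_3 x; the price is that z-smooth t are coprime
  to Q. Rankin's trick with the shift delta given by z^delta = y = log_2 x / log_3 x bounds their
  share by (log x)^(1 - b + o(1)): the saving x^(-delta) is (log x)^(-b + o(1)), the Euler product
  costs log z, and a further exp(3 y) is only (log x)^o(1). This must be o(log_2 x / log x), whence
  b > 2. The size log A = x log_2 x is large enough for log Q = O(x) to be negligible in log n, and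
  small enough that log(h/x) is still asymptotic to log_2 x, which is what the primes in (x, h]
  cost. With log n asymptotic to x log_2 x, h becomes c log n log_2 n log_4 n / (log_3 n)^2, and b
  -> 2 gives 3 / (2 pi^2). Because the final constant is explicit, a sieve with an unspecified
  constant would not do. Selberg's sieve gives the factor 2: its error Z^2 must stay below the
  interval length, so log Z is about half of log A. Elsewhere upper bounds of Mertens type with
  fixed error terms suffice.\<close>

definition primes_in :: "real \<Rightarrow> real \<Rightarrow> nat set" where
  "primes_in a b = {p. prime p \<and> a < real p \<and> real p \<le> b}"

lemma primes_in_subset: "primes_in a b \<subseteq> {..nat \<lfloor>b\<rfloor>}"
  by (auto simp: primes_in_def le_nat_floor)

lemma finite_primes_in [simp]: "finite (primes_in a b)"
  using primes_in_subset by (rule finite_subset) simp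

lemma primes_in_nonneg_eq: "primes_in 0 b = {p. prime p \<and> real p \<le> b}"
  by (auto simp: primes_in_def prime_gt_0_nat)

lemma primes_in_of_nat: "primes_in 0 (real n) = {p. prime p \<and> p \<le> n}"
  by (auto simp: primes_in_nonneg_eq)

lemma primes_in_floor:
  assumes "b \<ge> 0"
  shows "primes_in a b = primes_in a (real (nat \<lfloor>b\<rfloor>))"
proof -
  have "real p \<le> b \<longleftrightarrow> real p \<le> real (nat \<lfloor>b\<rfloor>)" for p
    using assms le_floor_iff[of "int p" b] le_nat_iff[of "\<lfloor>b\<rfloor>" p] of_nat_le_iff[of p "nat \<lfloor>b\<rfloor>", where 'a = real]
    by (simp del: of_nat_nat)
  then show ?thesis by (simp only: primes_in_def)
qed

lemma primes_dvd_imp_prod_dvd: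
  fixes n :: nat
  assumes "finite A" "\<And>p. p \<in> A \<Longrightarrow> prime p" "\<And>p. p \<in> A \<Longrightarrow> p dvd n"
  shows "\<Prod>A dvd n"
  using assms
proof (induction A rule: finite_induct)
  case (insert p A)
  have "coprime p (\<Prod>A)"
    using insert.hyps insert.prems by (intro prod_coprime_right primes_coprime) auto
  with insert show ?case by (auto intro!: divides_mult)
qed simp

text \<open>Erdos's induction. For n = 2m + 1 every prime in (m + 1, n] divides n choose m, which is
  at most 4^m because this coefficient occurs twice in a row with sum 2 * 4^m. An even n > 2 adds no
  prime.\<close>

lemma prod_primes_le_power4: "\<Prod>{p. prime p \<and> p \<le> n} \<le> 4 ^ n" for n :: nat
proof (induction n rule: less_induct)
  case (less n)
  consider "n \<le> 1" | "n = 2" | "n > 2" "even n" | "n > 2" "odd n" by linarith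
  then show ?case
  proof cases
    case 1
    have "{p. prime p \<and> p \<le> n} = {}"
      using 1 by (auto dest: prime_gt_1_nat)
    then show ?thesis by (simp only: prod.empty) simp
  next
    case 2
    have "{p. prime p \<and> p \<le> n} = {2}"
      using 2 by (auto intro: antisym dest: prime_ge_2_nat)
    then show ?thesis using 2 by simp
  next
    case 3
    have "\<not> prime n" using 3 by (metis primes_dvd_imp_eq two_is_prime_nat less_irrefl)
    then have "{p. prime p \<and> p \<le> n} = {p. prime p \<and> p \<le> n - 1}"
      using 3 by auto (metis Suc_pred le_SucE less_nat_zero_code not_gr_zero)
    moreover have "4 ^ (n - 1) \<le> (4 ^ n :: nat)" by (intro power_increasing) auto
    moreover have "\<Prod>{p. prime p \<and> p \<le> n - 1} \<le> 4 ^ (n - 1)"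
      using less.IH[of "n - 1"] 3 by simp
    ultimately show ?thesis by (metis order_trans)
  next
    case 4
    then obtain m where m: "n = 2 * m + 1" "m \<ge> 1" by (elim oddE) auto
    define A where "A = {p. prime p \<and> p \<le> m + 1}"
    define B where "B = {p. prime p \<and> m + 1 < p \<and> p \<le> n}"
    have fin: "finite A" "finite B" by (auto simp: A_def B_def)
    have "\<Prod>{p. prime p \<and> p \<le> n} = \<Prod>(A \<union> B)"
      using m by (intro arg_cong[where f = "\<Prod>"]) (auto simp: A_def B_def)
    also have "\<dots> = \<Prod>A * \<Prod>B"
      using fin by (intro prod.union_disjoint) (auto simp: A_def B_def)
    also have "\<Prod>A \<le> 4 ^ (m + 1)"
      using less.IH[of "m + 1"] m by (simp add: A_def)
    also have "\<Prod>B \<le> 4 ^ m"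
    proof -
      have "\<Prod>B dvd (n choose m)"
      proof (rule primes_dvd_imp_prod_dvd[OF fin(2)])
        fix p assume p: "p \<in> B"
        then show pp: "prime p" by (simp add: B_def)
        have "fact m * fact (n - m) * (n choose m) = (fact n :: nat)"
          using m by (intro binomial_fact_lemma) auto
        moreover have "p dvd (fact n :: nat)"
          using p pp by (auto simp: B_def prime_dvd_fact_iff)
        moreover have "\<not> p dvd (fact m :: nat)" "\<not> p dvd (fact (n - m) :: nat)"
          using p pp m by (simp_all add: B_def prime_dvd_fact_iff del: fact_Suc)
        ultimately show "p dvd (n choose m)"
          using pp by (metis prime_dvd_mult_iff)
      qed
      then have "\<Prod>B \<le> (n choose m)"
        using m by (intro dvd_imp_le) auto
      moreover have "2 * (n choose m) \<le> 2 ^ n"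
      proof -
        have "(n choose Suc m) = (n choose m)"
          using m binomial_symmetric[of "Suc m" n] by simp
        then have "2 * (n choose m) = (\<Sum>k\<in>{m, Suc m}. n choose k)" by simp
        also have "\<dots> \<le> (\<Sum>k\<le>n. n choose k)"
          using m by (intro sum_mono2) auto
        finally show ?thesis by (simp add: choose_row_sum)
      qed
      then have "(n choose m) \<le> 4 ^ m"
        using m by (simp add: power_mult)
      ultimately show ?thesis by linarith
    qed
    finally show ?thesis using m
      by (simp add: mult_le_mono power_add [symmetric] mult_2 del: power_Suc)
  qed
qed

lemma theta_le:
  assumes "x \<ge> 0"
  shows "(\<Sum>p\<in>primes_in 0 x. ln (real p)) \<le> x * ln 4"
proof -
  define n where "n = nat \<lfloor>x\<rfloor>"
  have "(\<Sum>p\<in>primes_in 0 x. ln (real p)) = ln (\<Prod>p\<in>primes_in 0 x. real p)"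
    by (intro ln_prod [symmetric] finite_primes_in) (auto simp: primes_in_def)
  also have "(\<Prod>p\<in>primes_in 0 x. real p) = real (\<Prod>{p. prime p \<and> p \<le> n})"
    using assms by (simp only: primes_in_floor[of x] n_def primes_in_of_nat) simp
  also have "ln \<dots> \<le> ln (real (4 ^ n))"
    by (subst ln_le_cancel_iff)
      (auto simp del: of_nat_prod of_nat_power simp: prod_primes_le_power4 intro!: prod_pos prime_gt_0_nat)
  also have "\<dots> = real n * ln 4" by (simp add: ln_realpow)
  also have "\<dots> \<le> x * ln 4" using assms by (intro mult_right_mono) (auto simp: n_def)
  finally show ?thesis .
qed

section \<open>Mertens's first estimate from the factorisation of n!\<close>

lemma multiplicity_fact_rec:
  assumes p: "prime p"
  shows "multiplicity p (fact n :: nat) = n div p + multiplicity p (fact (n div p) :: nat)"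
proof (induction n)
  case (Suc n)
  have p1: "p > 1" using p by (rule prime_gt_1_nat)
  have *: "multiplicity p (fact (Suc n) :: nat) = multiplicity p (Suc n) + multiplicity p (fact n :: nat)"
    using p by (subst fact_Suc) (simp add: prime_elem_multiplicity_mult_distrib del: of_nat_Suc mult_Suc)
  show ?case
  proof (cases "p dvd Suc n")
    case True
    then obtain k where k: "Suc n = p * k" by blast
    have k0: "k > 0" using k by (cases k) auto
    have d: "Suc n div p = k" using k p1 by simp
    have d': "n div p = k - 1"
    proof -
      have "n = p * (k - 1) + (p - 1)" using k k0 p1
        by (cases k) (auto simp: algebra_simps)
      then have "n div p = (p * (k - 1) + (p - 1)) div p" by simp
      also have "\<dots> = k - 1" using p1 by (subst div_mult_self4) auto
      finally show ?thesis .
    qed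
    have "multiplicity p (Suc n) = Suc (multiplicity p k)"
      using k0 p1 unfolding k by (subst multiplicity_times_same) auto
    moreover have "multiplicity p (fact k :: nat) = multiplicity p k + multiplicity p (fact (k - 1) :: nat)"
      using k0 p by (cases k) (simp_all add: prime_elem_multiplicity_mult_distrib fact_Suc del: of_nat_Suc mult_Suc)
    ultimately show ?thesis using Suc * d d' k0 by simp
  next
    case False
    then have "Suc n div p = n div p" "multiplicity p (Suc n) = 0"
      by (auto simp: div_Suc dvd_eq_mod_eq_0 not_dvd_imp_multiplicity_0)
    then show ?thesis using Suc * by simp
  qed
qed simp

text \<open>Iterating Legendre's recursion amounts to summing a geometric series; its value n/(p -
  1) is reproduced by one step, as n/p + (n/p)/(p - 1) = n/(p - 1).\<close>

lemma multiplicity_fact_le: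
  assumes p: "prime p"
  shows "real (multiplicity p (fact n :: nat)) \<le> real n / (real p - 1)"
proof (induction n rule: less_induct)
  case (less n)
  have p1: "p > 1" using p by (rule prime_gt_1_nat)
  show ?case
  proof (cases "n = 0")
    case False
    then have "n div p < n" using p1 by simp
    from less.IH[OF this]
    have "real (multiplicity p (fact n :: nat)) \<le> real (n div p) + real (n div p) / (real p - 1)"
      using multiplicity_fact_rec[OF p, of n] by simp
    also have "\<dots> = real (n div p) * (real p / (real p - 1))"
      using p1 by (simp add: field_simps)
    also have "\<dots> \<le> (real n / real p) * (real p / (real p - 1))"
      using p1 by (intro mult_right_mono of_nat_div_le_of_nat) auto
    also have "\<dots> = real n / (real p - 1)" using p1 by (simp add: field_simps)
    finally show ?thesis .
  qed simp
qed

lemma ln_fact_eq_sum_primes: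
  "ln (fact n :: real) = (\<Sum>p\<in>primes_in 0 n. real (multiplicity p (fact n :: nat)) * ln (real p))"
proof -
  have pf: "prime_factors (fact n :: nat) = primes_in 0 n"
    by (auto simp: prime_factors_dvd prime_dvd_fact_iff primes_in_of_nat)
  have "real (fact n) = real (\<Prod>p\<in>prime_factors (fact n :: nat). p ^ multiplicity p (fact n :: nat))"
    by (subst prime_factorization_nat[symmetric]) auto
  then have "ln (fact n :: real) = ln (\<Prod>p\<in>primes_in 0 n. real p ^ multiplicity p (fact n :: nat))"
    by (simp add: pf)
  also have "\<dots> = (\<Sum>p\<in>primes_in 0 n. ln (real p ^ multiplicity p (fact n :: nat)))"
    by (rule ln_prod) (auto simp: primes_in_def prime_gt_0_nat)
  also have "\<dots> = (\<Sum>p\<in>primes_in 0 n. real (multiplicity p (fact n :: nat)) * ln (real p))"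
    by (intro sum.cong) (auto simp: ln_realpow primes_in_def prime_gt_0_nat)
  finally show ?thesis .
qed

lemma ln_fact_le: "ln (fact n :: real) \<le> real n * ln (real n)"
proof (cases "n = 0")
  case False
  have "ln (fact n :: real) \<le> ln (real (n ^ n))"
    using fact_le_power[of n, where 'a = real] False by (subst ln_le_cancel_iff) auto
  then show ?thesis using False by (simp add: ln_realpow)
qed simp

lemma ln_fact_ge: "ln (fact n :: real) \<ge> real n * ln (real n) - real n"
proof (induction n)
  case (Suc n)
  show ?case
  proof (cases "n = 0")
    case False
    have "real n * (ln (real (Suc n)) - ln (real n)) \<le> 1"
    proof -
      have "ln (real (Suc n)) - ln (real n) = ln (1 + 1 / real n)"
        using False ln_div[of "real (Suc n)" "real n"] by (simp add: add_divide_distrib add.commute)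
      also have "\<dots> \<le> 1 / real n" by (intro ln_add_one_self_le_self) auto
      finally show ?thesis using False by (simp add: field_simps)
    qed
    moreover have "ln (fact (Suc n) :: real) = ln (real (Suc n)) + ln (fact n)"
      by (simp add: ln_mult)
    ultimately show ?thesis using Suc by (simp add: algebra_simps)
  qed simp
qed simp


text \<open>Legendre's recursion gives n/p - 1 as a lower bound for the multiplicity of p in n!. The
  loss of one ln p per prime adds up to theta(n), which Chebyshev's bound keeps below n ln
  4.\<close>

lemma mertens1_upper:
  fixes n :: nat
  assumes "n \<ge> 1"
  shows "(\<Sum>p\<in>primes_in 0 n. ln (real p) / real p) \<le> ln (real n) + ln 4"
proof -
  have "real n * (\<Sum>p\<in>primes_in 0 n. ln (real p) / real p) =
      (\<Sum>p\<in>primes_in 0 n. (real n / real p) * ln (real p))"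
    by (simp add: sum_distrib_left)
  also have "\<dots> \<le> (\<Sum>p\<in>primes_in 0 n. (real (multiplicity p (fact n :: nat)) + 1) * ln (real p))"
  proof (intro sum_mono mult_right_mono)
    fix p assume p: "p \<in> primes_in 0 n"
    then have pp: "prime p" by (simp add: primes_in_def)
    have "real n / real p \<le> real (n div p) + 1"
      using floor_divide_of_nat_eq[of n p, where 'a = real] by linarith
    also have "\<dots> \<le> real (multiplicity p (fact n :: nat)) + 1"
      using multiplicity_fact_rec[OF pp, of n] by simp
    finally show "real n / real p \<le> \<dots>" .
    show "ln (real p) \<ge> 0" using prime_gt_1_nat[OF pp] by simp
  qed
  also have "\<dots> = ln (fact n) + (\<Sum>p\<in>primes_in 0 n. ln (real p))"
    by (simp add: ln_fact_eq_sum_primes algebra_simps sum.distrib)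
  also have "\<dots> \<le> real n * ln (real n) + real n * ln 4"
    by (intro add_mono ln_fact_le theta_le) auto
  also have "\<dots> = real n * (ln (real n) + ln 4)" by (simp add: algebra_simps)
  finally show ?thesis using assms by simp
qed

text \<open>Telescoping against a discrete antiderivative: -(ln t + 1)/t is the antiderivative of ln
  t / t^2, and 2 in place of 1 absorbs the discretisation. At n = 1 both sides vanish.\<close>

lemma sum_ln_over_consecutive_le:
  fixes n :: nat
  assumes "n \<ge> 1"
  shows "(\<Sum>m=2..n. ln (real m) / (real m * (real m - 1))) \<le> 2 - (ln (real n) + 2) / real n"
  using assms
proof (induction n rule: dec_induct)
  case (step n)
  have n: "real n > 0" using step by simp
  have "real n * (ln (real n + 1) - ln (real n)) \<le> 1"
    using ln_le_minus_one[of "(real n + 1) / real n"] n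
    by (simp add: ln_div field_simps)
  moreover have "ln (real n + 1) - ln (real n) \<le> 1"
  proof -
    have "ln (real n + 1) - ln (real n) \<le> 1 / real n"
      using ln_add_one_self_le_self[of "1 / real n"] n ln_div[of "real n + 1" "real n"]
      by (simp add: add_divide_distrib add.commute)
    also have "\<dots> \<le> 1" using step(1) by simp
    finally show ?thesis .
  qed
  ultimately have "(real n + 1) * (ln (real n + 1) - ln (real n)) \<le> 2"
    by (simp add: algebra_simps)
  then have "ln (real n + 1) / (real n * (real n + 1)) \<le>
      (ln (real n) + 2) / real n - (ln (real n + 1) + 2) / (real n + 1)"
    using n by (simp add: divide_simps) (simp add: algebra_simps)
  then show ?case using step by (simp add: add.commute mult.commute)
qed simp

text \<open>Here the multiplicity is bounded above by n/(p - 1). The 3 is 1 from the Stirling-type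
  bound for n! plus 2 from replacing 1/(p - 1) by 1/p.\<close>

lemma mertens1_lower:
  fixes n :: nat
  assumes "n \<ge> 1"
  shows "(\<Sum>p\<in>primes_in 0 n. ln (real p) / real p) \<ge> ln (real n) - 3"
proof -
  have "real n * (ln (real n) - 1) \<le> ln (fact n)"
    using ln_fact_ge[of n] by (simp add: algebra_simps)
  also have "\<dots> \<le> (\<Sum>p\<in>primes_in 0 n. real n / (real p - 1) * ln (real p))"
    unfolding ln_fact_eq_sum_primes
    by (intro sum_mono mult_right_mono multiplicity_fact_le)
      (auto simp: primes_in_def prime_ge_1_nat)
  also have "\<dots> = real n * (\<Sum>p\<in>primes_in 0 n. ln (real p) / (real p - 1))"
    by (simp add: sum_distrib_left)
  finally have "ln (real n) - 1 \<le> (\<Sum>p\<in>primes_in 0 n. ln (real p) / (real p - 1))"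
    using assms by simp
  also have "\<dots> = (\<Sum>p\<in>primes_in 0 n. ln (real p) / real p + ln (real p) / (real p * (real p - 1)))"
  proof (intro sum.cong refl)
    fix p assume "p \<in> primes_in 0 n"
    then have "real p > 1" using prime_gt_1_nat[of p] by (simp add: primes_in_def)
    then show "ln (real p) / (real p - 1) = ln (real p) / real p + ln (real p) / (real p * (real p - 1))"
      by (simp add: divide_simps) (simp add: algebra_simps)
  qed
  also have "\<dots> = (\<Sum>p\<in>primes_in 0 n. ln (real p) / real p) +
      (\<Sum>p\<in>primes_in 0 n. ln (real p) / (real p * (real p - 1)))"
    by (rule sum.distrib)
  also have "(\<Sum>p\<in>primes_in 0 n. ln (real p) / (real p * (real p - 1))) \<le>
      (\<Sum>m=2..n. ln (real m) / (real m * (real m - 1)))"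
    by (intro sum_mono2 divide_nonneg_nonneg mult_nonneg_nonneg)
      (auto simp: primes_in_def intro: prime_ge_2_nat less_imp_le[OF prime_gt_1_nat])
  also have "\<dots> \<le> 2"
    using sum_ln_over_consecutive_le[OF assms] assms
    by (smt (verit) divide_nonneg_nonneg ln_ge_zero of_nat_0_le_iff of_nat_1 of_nat_mono)
  finally show ?thesis by simp
qed

text \<open>Mertens's second estimate. Abel summation is done as an induction on b that carries the
  boundary term \<open>e b / ln b\<close> along; the integral of 1/(t ln t) enters as 1 - u/v <= ln
  v - ln u for consecutive logarithms u, v.\<close>

lemma sum_inverse_primes_nat_le:
  fixes a b :: nat
  assumes "2 \<le> a" "a \<le> b"
  shows "(\<Sum>p\<in>primes_in a b. 1 / real p) \<le> ln (ln (real b)) - ln (ln (real a)) + 6 / ln (real a)"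
proof -
  define A where "A n = (\<Sum>p\<in>primes_in 0 (real n). ln (real p) / real p)" for n :: nat
  \<comment> \<open>The shift by 3 gives -6 <= e <= 0. The sign lets the term with
    \<open>e n * (1 / u - 1 / v)\<close> be dropped in each step, and the lower bound -6 pays for
    the base case.\<close>
  define e where "e n = A n - ln (real n) - 3" for n :: nat
  have ln4: "ln (4 :: real) \<le> 3" using ln_le_minus_one[of "4 :: real"] by simp
  have e_le: "e n \<le> 0" if "n \<ge> 2" for n
    using mertens1_upper[of n] that ln4 by (simp add: e_def A_def)
  have e_ge: "e n \<ge> -6" if "n \<ge> 2" for n
    using mertens1_lower[of n] that by (simp add: e_def A_def)
  have "(\<Sum>p\<in>primes_in a b. 1 / real p) \<le>
      e b / ln (real b) + ln (ln (real b)) - ln (ln (real a)) + 6 / ln (real a)"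
    using assms(2)
  proof (induction b rule: dec_induct)
    case base
    have "primes_in a a = {}" by (auto simp: primes_in_def)
    moreover have "e a / ln (real a) + 6 / ln (real a) \<ge> 0"
      using e_ge[OF assms(1)] assms(1) by (simp add: add_divide_distrib [symmetric])
    ultimately show ?case by simp
  next
    case (step n)
    have n2: "n \<ge> 2" using step assms by simp
    define c where "c = (if prime (Suc n) then ln (real (Suc n)) / real (Suc n) else 0)"
    define u where "u = ln (real n)"
    define v where "v = ln (real (Suc n))"
    have u: "u > 0" "u < v" using n2 by (auto simp: u_def v_def)
    have ins: "primes_in x (Suc n) = (if prime (Suc n) then insert (Suc n) (primes_in x n) else primes_in x n)"
      if "x \<le> real n" for x
    proof -
      have "real p \<le> real (Suc n) \<longleftrightarrow> p = Suc n \<or> real p \<le> real n" for p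
        by (auto simp flip: of_nat_Suc)
      then show ?thesis using that by (auto simp: primes_in_def)
    qed
    have notin: "Suc n \<notin> primes_in x n" for x by (auto simp: primes_in_def)
    have A: "A (Suc n) = A n + c"
      unfolding A_def c_def by (subst ins) (auto simp: notin)
    have D: "(\<Sum>p\<in>primes_in a (Suc n). 1 / real p) = (\<Sum>p\<in>primes_in a n. 1 / real p) + c / v"
      using u step(1) unfolding c_def v_def by (subst ins) (auto simp: notin)
    have "e n * (1 / u - 1 / v) \<le> 0"
      using e_le[OF n2] u by (intro mult_nonpos_nonneg) (auto simp: divide_simps)
    moreover have "1 - u / v \<le> ln v - ln u"
      using ln_le_minus_one[of "u / v"] u by (simp add: ln_div)
    moreover have "e (Suc n) = e n + c - (v - u)"
      by (simp add: e_def A u_def v_def)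
    then have "e (Suc n) / v = e n / v + c / v - 1 + u / v"
      using u by (simp add: field_simps)
    ultimately have "e n / u + c / v + ln u \<le> e (Suc n) / v + ln v"
      by (simp add: right_diff_distrib)
    then show ?case using step.IH D by (simp add: u_def v_def)
  qed
  moreover have "e b / ln (real b) \<le> 0"
    using e_le[of b] assms by (simp add: divide_nonpos_pos)
  ultimately show ?thesis by linarith
qed

lemma ln_floor_ge:
  fixes a :: real
  assumes "2 \<le> a"
  shows "ln (real (nat \<lfloor>a\<rfloor>)) \<ge> ln a / 2"
proof -
  define n where "n = nat \<lfloor>a\<rfloor>"
  have n: "n \<ge> 2" "a \<le> real n + 1" using assms by (auto simp: n_def le_nat_iff le_floor_iff)
  have "real n + 1 \<le> 2 * real n" using n by simp
  also have "\<dots> \<le> real n * real n" using n by (intro mult_right_mono) auto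
  finally have "a \<le> real n ^ 2" using n by (simp add: power2_eq_square)
  then have "ln a \<le> ln (real n ^ 2)" using assms n by (subst ln_le_cancel_iff) auto
  then show ?thesis using n by (simp add: ln_realpow n_def)
qed

text \<open>Rounding a down to an integer m at most halves ln a, which turns 6 into 12; the
  thirteenth unit pays for ln (ln a) - ln (ln m).\<close>

theorem sum_inverse_primes_le:
  fixes a b :: real
  assumes "2 \<le> a" "a \<le> b"
  shows "(\<Sum>p\<in>primes_in a b. 1 / real p) \<le> ln (ln b) - ln (ln a) + 13 / ln a"
proof -
  define m where "m = nat \<lfloor>a\<rfloor>"
  define n where "n = nat \<lfloor>b\<rfloor>"
  have m: "m \<ge> 2" "a \<le> real m + 1" "real m \<le> a"
    using assms by (auto simp: m_def le_nat_iff le_floor_iff)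
  have n: "m \<le> n" "real n \<le> b" using assms by (auto simp: m_def n_def nat_mono floor_mono)
  have lm: "ln (real m) \<ge> ln a / 2" using ln_floor_ge[OF assms(1)] by (simp add: m_def)
  have la: "ln a > 0" using assms by simp
  have "(\<Sum>p\<in>primes_in a b. 1 / real p) \<le> (\<Sum>p\<in>primes_in m n. 1 / real p)"
  proof (intro sum_mono2)
    have "primes_in a b \<subseteq> primes_in m b" using m by (auto simp: primes_in_def)
    also have "\<dots> = primes_in m n" using assms unfolding n_def by (intro primes_in_floor) simp
    finally show "primes_in a b \<subseteq> primes_in m n" .
  qed auto
  also have "\<dots> \<le> ln (ln (real n)) - ln (ln (real m)) + 6 / ln (real m)"
    using m n by (intro sum_inverse_primes_nat_le)
  also have "ln (ln (real n)) \<le> ln (ln b)" using m n assms by simp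
  also have "6 / ln (real m) \<le> 6 / (ln a / 2)"
    using lm la by (intro divide_left_mono) auto
  finally have 1: "(\<Sum>p\<in>primes_in a b. 1 / real p) \<le> ln (ln b) - ln (ln (real m)) + 12 / ln a"
    by simp
  have lm0: "ln (real m) > 0" using m by simp
  have "ln (ln a) - ln (ln (real m)) = ln (ln a / ln (real m))"
    using la lm0 by (simp add: ln_div)
  also have "\<dots> \<le> ln a / ln (real m) - 1"
    using la lm0 by (intro ln_le_minus_one) auto
  also have "\<dots> = ln (a / real m) / ln (real m)"
    using lm0 m assms by (simp add: ln_div field_simps)
  also have "\<dots> \<le> (1 / 2) / (ln a / 2)"
  proof (intro frac_le)
    have "ln (a / real m) \<le> a / real m - 1" using m assms by (intro ln_le_minus_one) auto
    also have "\<dots> \<le> 1 / 2" using m by (simp add: field_simps)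
    finally show "ln (a / real m) \<le> 1 / 2" .
  qed (use la lm in auto)
  finally have "ln (ln a) - ln (ln (real m)) \<le> 1 / ln a" by simp
  with 1 show ?thesis by (simp add: add_divide_distrib [symmetric])
qed

section \<open>The Selberg sieve\<close>

text \<open>A squarefree d composed of primes of \<open>A\<close> is encoded as its set of prime
  factors: then d is \<open>\<Prod>B\<close>, gcd and lcm become intersection and union, and the
  Moebius function becomes the sign given by the cardinality. \<open>Z\<close> is the level of the
  sieve.\<close>

definition sieve_sets :: "nat set \<Rightarrow> nat \<Rightarrow> nat set set" where
  "sieve_sets A Z = {B. B \<subseteq> A \<and> \<Prod>B \<le> Z}"

text \<open>This is 1/phi(d) for d = \<open>\<Prod>B\<close>.\<close>

definition sieve_weight :: "nat set \<Rightarrow> real" where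
  "sieve_weight B = (\<Prod>p\<in>B. 1 / (real p - 1))"

text \<open>Selberg's sum of mu(d)^2/phi(d), the denominator in the main term of the sieve.\<close>

definition sieve_sum :: "nat set \<Rightarrow> nat \<Rightarrow> real" where
  "sieve_sum A Z = (\<Sum>B\<in>sieve_sets A Z. sieve_weight B)"

text \<open>This is d/phi(d) for d = \<open>\<Prod>B\<close>.\<close>

definition totient_ratio :: "nat set \<Rightarrow> real" where
  "totient_ratio B = (\<Prod>p\<in>B. real p / (real p - 1))"

section \<open>Recursions for the sieve sum\<close>

lemma prime_real_gt_1: "prime p \<Longrightarrow> real p > 1"
  using prime_gt_1_nat[of p] by simp

lemma finite_sieve_sets: "finite A \<Longrightarrow> finite (sieve_sets A Z)"
  by (rule finite_subset[of _ "Pow A"]) (auto simp: sieve_sets_def)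

lemma sieve_weight_pos:
  assumes "\<And>p. p \<in> B \<Longrightarrow> prime p"
  shows "sieve_weight B > 0"
  unfolding sieve_weight_def
proof (rule prod_pos)
  fix p assume "p \<in> B"
  then have "real p > 1" using assms by (blast intro: prime_real_gt_1)
  then show "0 < 1 / (real p - 1)" by simp
qed

lemma sieve_sum_nonneg:
  assumes "\<And>p. p \<in> A \<Longrightarrow> prime p"
  shows "sieve_sum A Z \<ge> 0"
  unfolding sieve_sum_def using assms
  by (intro sum_nonneg less_imp_le[OF sieve_weight_pos]) (auto simp: sieve_sets_def)

lemma sieve_sum_mono:
  assumes "finite A" "\<And>p. p \<in> A \<Longrightarrow> prime p" "Z \<le> Z'"
  shows "sieve_sum A Z \<le> sieve_sum A Z'"
  unfolding sieve_sum_def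
proof (rule sum_mono2)
  show "finite (sieve_sets A Z')" using assms(1) by (rule finite_sieve_sets)
  show "sieve_sets A Z \<subseteq> sieve_sets A Z'" using assms by (auto simp: sieve_sets_def)
  fix B assume "B \<in> sieve_sets A Z' - sieve_sets A Z"
  then show "0 \<le> sieve_weight B"
    using assms by (intro less_imp_le[OF sieve_weight_pos]) (auto simp: sieve_sets_def)
qed

text \<open>The sets containing \<open>p\<close> are \<open>insert p C\<close> with
  \<open>\<Prod>C \<le> Z div p\<close>; integer division loses nothing here. Monotonicity in the
  level turns this identity into the upper and the lower one-prime bound that follow.\<close>

lemma sieve_sum_insert:
  assumes "finite A" "p \<notin> A" "p > 0"
  shows "sieve_sum (insert p A) Z = sieve_sum A Z + sieve_sum A (Z div p) / (real p - 1)"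
proof -
  have fin: "finite B" if "B \<subseteq> A" for B using that assms finite_subset by blast
  have eq: "sieve_sets (insert p A) Z = sieve_sets A Z \<union> insert p ` sieve_sets A (Z div p)"
    (is "?L = ?R")
  proof (intro equalityI subsetI)
    fix B assume B: "B \<in> ?L"
    show "B \<in> ?R"
    proof (cases "p \<in> B")
      case True
      define C where "C = B - {p}"
      have C: "B = insert p C" "p \<notin> C" "C \<subseteq> A"
        using True B by (auto simp: C_def sieve_sets_def)
      then have "\<Prod>B = \<Prod>C * p" using fin[of C] by simp
      then have "\<Prod>C \<le> Z div p"
        using B assms by (simp add: sieve_sets_def less_eq_div_iff_mult_less_eq)
      then show ?thesis using C by (auto simp: sieve_sets_def)
    qed (use B in \<open>auto simp: sieve_sets_def\<close>)
  next
    fix B assume "B \<in> ?R"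
    then consider "B \<in> sieve_sets A Z" | C where "B = insert p C" "C \<in> sieve_sets A (Z div p)"
      by blast
    then show "B \<in> ?L"
    proof cases
      case 2
      then have "\<Prod>B = \<Prod>C * p" using fin[of C] assms
        by (subst \<open>B = insert p C\<close>, subst prod.insert) (auto simp: sieve_sets_def)
      then show ?thesis
        using 2 assms by (auto simp: sieve_sets_def less_eq_div_iff_mult_less_eq)
    qed (auto simp: sieve_sets_def)
  qed
  have "sieve_sum (insert p A) Z =
      (\<Sum>B\<in>sieve_sets A Z. sieve_weight B) + (\<Sum>B\<in>insert p ` sieve_sets A (Z div p). sieve_weight B)"
    unfolding sieve_sum_def eq using assms
    by (intro sum.union_disjoint) (auto intro: finite_sieve_sets simp: sieve_sets_def)
  also have "(\<Sum>B\<in>insert p ` sieve_sets A (Z div p). sieve_weight B) =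
      (\<Sum>B\<in>sieve_sets A (Z div p). sieve_weight (insert p B))"
    using assms(2) by (intro sum.reindex_cong[where l = "insert p"] inj_onI refl)
      (auto simp: sieve_sets_def)
  also have "\<dots> = (\<Sum>B\<in>sieve_sets A (Z div p). sieve_weight B / (real p - 1))"
  proof (intro sum.cong refl)
    fix B assume "B \<in> sieve_sets A (Z div p)"
    then have "p \<notin> B" "finite B" using assms fin by (auto simp: sieve_sets_def)
    then show "sieve_weight (insert p B) = sieve_weight B / (real p - 1)"
      by (simp add: sieve_weight_def)
  qed
  finally show ?thesis by (simp add: sieve_sum_def sum_divide_distrib)
qed

lemma sieve_sum_insert_le:
  assumes "finite A" "p \<notin> A" "prime p" "\<And>q. q \<in> A \<Longrightarrow> prime q"
  shows "sieve_sum (insert p A) Z \<le> real p / (real p - 1) * sieve_sum A Z"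
proof -
  have p: "real p > 1" using prime_gt_1_nat[OF assms(3)] by simp
  have "sieve_sum (insert p A) Z = sieve_sum A Z + sieve_sum A (Z div p) / (real p - 1)"
    using assms by (intro sieve_sum_insert) (auto simp: prime_gt_0_nat)
  also have "\<dots> \<le> sieve_sum A Z + sieve_sum A Z / (real p - 1)"
    using assms p by (intro add_left_mono divide_right_mono sieve_sum_mono) auto
  finally show ?thesis using p by (simp add: field_simps)
qed

lemma sieve_sum_insert_ge:
  assumes "finite A" "p \<notin> A" "prime p" "\<And>q. q \<in> A \<Longrightarrow> prime q"
  shows "sieve_sum (insert p A) Z \<ge> real p / (real p - 1) * sieve_sum A (Z div p)"
proof -
  have p: "real p > 1" using prime_gt_1_nat[OF assms(3)] by simp
  have "real p / (real p - 1) * sieve_sum A (Z div p) =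
      sieve_sum A (Z div p) + sieve_sum A (Z div p) / (real p - 1)"
    using p by (simp add: field_simps)
  also have "\<dots> \<le> sieve_sum A Z + sieve_sum A (Z div p) / (real p - 1)"
    using assms by (intro add_right_mono sieve_sum_mono) auto
  also have "\<dots> = sieve_sum (insert p A) Z"
    using assms by (intro sieve_sum_insert [symmetric]) (auto simp: prime_gt_0_nat)
  finally show ?thesis .
qed

lemma totient_ratio_pos:
  assumes "\<And>p. p \<in> B \<Longrightarrow> prime p"
  shows "totient_ratio B > 0"
  unfolding totient_ratio_def
proof (rule prod_pos)
  fix p assume "p \<in> B"
  then have "real p > 1" using assms by (blast intro: prime_real_gt_1)
  then show "0 < real p / (real p - 1)" by simp
qed

lemma totient_ratio_mono:
  assumes "finite C" "B \<subseteq> C" "\<And>p. p \<in> C \<Longrightarrow> prime p"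
  shows "totient_ratio B \<le> totient_ratio C"
  unfolding totient_ratio_def
proof (rule prod_mono2)
  have gt: "real p > 1" if "p \<in> C" for p using assms(3)[OF that] by (rule prime_real_gt_1)
  show "1 \<le> real p / (real p - 1)" if "p \<in> C - B" for p
    using gt[of p] that by (simp add: field_simps)
  show "0 \<le> real p / (real p - 1)" if "p \<in> B" for p
    using gt[of p] that assms(2) by (auto simp: field_simps)
qed (use assms in auto)

text \<open>Adjoining the primes of Q costs at most a factor Q/phi(Q); this is how the sum over
  primes not dividing Q gets its lower bound.\<close>

lemma sieve_sum_union_le:
  assumes "finite B" "finite A" "A \<inter> B = {}" "\<And>q. q \<in> A \<union> B \<Longrightarrow> prime q"
  shows "sieve_sum (A \<union> B) Z \<le> totient_ratio B * sieve_sum A Z"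
  using assms
proof (induction B rule: finite_induct)
  case (insert p B)
  have "sieve_sum (A \<union> insert p B) Z \<le> real p / (real p - 1) * sieve_sum (A \<union> B) Z"
    using insert by (subst Un_insert_right, intro sieve_sum_insert_le) auto
  also have "\<dots> \<le> real p / (real p - 1) * (totient_ratio B * sieve_sum A Z)"
    using insert prime_gt_1_nat[of p] by (intro mult_left_mono insert.IH) auto
  finally show ?case using insert.hyps by (simp add: totient_ratio_def)
qed (simp add: totient_ratio_def)

text \<open>Dividing the level by the whole product leaves room for every subset of
  \<open>B\<close>, and the weights of all these subsets add up to \<open>totient_ratio B\<close>.
  This is the inequality behind |lambda_d| <= 1 in \<open>abs_lam_le\<close>.\<close>

lemma sieve_sum_union_ge:
  assumes "finite B" "finite A" "A \<inter> B = {}" "\<And>q. q \<in> A \<union> B \<Longrightarrow> prime q"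
  shows "sieve_sum (A \<union> B) Z \<ge> totient_ratio B * sieve_sum A (Z div \<Prod>B)"
  using assms
proof (induction B arbitrary: Z rule: finite_induct)
  case (insert p B)
  have "totient_ratio (insert p B) * sieve_sum A (Z div \<Prod>(insert p B)) =
      real p / (real p - 1) * (totient_ratio B * sieve_sum A (Z div p div \<Prod>B))"
    using insert.hyps by (simp add: totient_ratio_def div_mult2_eq)
  also have "\<dots> \<le> real p / (real p - 1) * sieve_sum (A \<union> B) (Z div p)"
    using insert prime_gt_1_nat[of p] by (intro mult_left_mono insert.IH) auto
  also have "\<dots> \<le> sieve_sum (A \<union> insert p B) Z"
    using insert by (subst Un_insert_right, intro sieve_sum_insert_ge) auto
  finally show ?case .
qed (simp add: totient_ratio_def)

section \<open>Lower bound for the sieve sum\<close>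

definition smooth_upto :: "nat set \<Rightarrow> nat \<Rightarrow> nat set" where
  "smooth_upto A N = {n. 1 \<le> n \<and> n \<le> N \<and> prime_factors n \<subseteq> A}"

lemma finite_smooth_upto [simp]: "finite (smooth_upto A N)"
  by (rule finite_subset[of _ "{..N}"]) (auto simp: smooth_upto_def)

text \<open>Splitting the sum over smooth numbers according to divisibility by a single prime replaces
  the Euler product by a recursion that stays within finite sums.\<close>

lemma sum_smooth_insert:
  fixes g :: "nat \<Rightarrow> real"
  assumes p: "prime p" "p \<notin> A"
    and mult: "\<And>n. g (p * n) = g p * g n"
  shows "(\<Sum>n\<in>smooth_upto (insert p A) N. g n) =
    (\<Sum>n\<in>smooth_upto A N. g n) + g p * (\<Sum>n\<in>smooth_upto (insert p A) (N div p). g n)"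
proof -
  have p0: "p > 0" using p by (simp add: prime_gt_0_nat)
  have eq: "smooth_upto (insert p A) N = smooth_upto A N \<union> (*) p ` smooth_upto (insert p A) (N div p)"
    (is "?L = ?R")
  proof (intro equalityI subsetI)
    fix n assume n: "n \<in> ?L"
    show "n \<in> ?R"
    proof (cases "p dvd n")
      case True
      then obtain k where k: "n = p * k" by blast
      then have "k > 0" using n by (cases k) (auto simp: smooth_upto_def)
      moreover have "prime_factors k \<subseteq> prime_factors n"
        using k n by (intro dvd_prime_factors) (auto simp: smooth_upto_def)
      moreover have "k \<le> N div p"
        using n p0 k by (simp add: smooth_upto_def less_eq_div_iff_mult_less_eq mult.commute)
      ultimately show ?thesis using n k by (auto simp: smooth_upto_def)
    next
      case False
      then have "p \<notin> prime_factors n" by (auto simp: prime_factors_dvd)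
      then show ?thesis using n by (auto simp: smooth_upto_def)
    qed
  next
    fix n assume "n \<in> ?R"
    then consider "n \<in> smooth_upto A N"
      | k where "n = p * k" "k \<in> smooth_upto (insert p A) (N div p)" by blast
    then show "n \<in> ?L"
    proof cases
      case 2
      then have "k > 0" by (simp add: smooth_upto_def)
      then have "prime_factors n = insert p (prime_factors k)"
        using 2 p p0 by (simp add: prime_factors_product prime_prime_factors)
      then show ?thesis
        using 2 p0 by (auto simp: smooth_upto_def less_eq_div_iff_mult_less_eq mult.commute)
    qed (auto simp: smooth_upto_def)
  qed
  have disj: "smooth_upto A N \<inter> (*) p ` smooth_upto (insert p A) (N div p) = {}"
  proof (rule ccontr)
    assume "\<not> ?thesis"
    then obtain k where k: "p * k \<in> smooth_upto A N" by blast
    then have "p \<in> prime_factors (p * k)"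
      using p by (simp add: smooth_upto_def prime_factors_dvd)
    then show False using k p(2) by (auto simp: smooth_upto_def)
  qed
  have "(\<Sum>n\<in>(*) p ` smooth_upto (insert p A) (N div p). g n) =
      (\<Sum>n\<in>smooth_upto (insert p A) (N div p). g (p * n))"
    using p0 by (subst sum.reindex) (auto simp: inj_on_def)
  also have "\<dots> = g p * (\<Sum>n\<in>smooth_upto (insert p A) (N div p). g n)"
    by (simp add: mult sum_distrib_left)
  finally show ?thesis
    unfolding eq using disj by (subst sum.union_disjoint) auto
qed

text \<open>The number 1/phi(d) is the sum of 1/n over all n with radical d, and n <= N forces the
  radical to be at most N. Instead of these infinite series the proof compares the recursions of
  both sides in a new prime \<open>p\<close>, by induction on \<open>A\<close> and then on
  \<open>N\<close>.\<close>

lemma sum_inverse_smooth_le_sieve_sum: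
  assumes "finite A" "\<And>p. p \<in> A \<Longrightarrow> prime p"
  shows "(\<Sum>n\<in>smooth_upto A N. 1 / real n) \<le> sieve_sum A N"
  using assms
proof (induction A arbitrary: N rule: finite_induct)
  case empty
  have "(\<Sum>n\<in>smooth_upto {} N. 1 / real n) \<le> (\<Sum>n\<in>(if N \<ge> 1 then {1} else {}). 1 / real n)"
    by (intro sum_mono2) (auto simp: smooth_upto_def prime_factorization_empty_iff)
  also have "\<dots> = sieve_sum {} N"
  proof -
    have "sieve_sets {} N = (if N \<ge> 1 then {{}} else {})" by (auto simp: sieve_sets_def)
    then show ?thesis by (simp add: sieve_sum_def sieve_weight_def)
  qed
  finally show ?case .
next
  case (insert p A)
  have p: "prime p" and A: "\<And>q. q \<in> A \<Longrightarrow> prime q" using insert.prems by auto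
  have p1: "real p > 1" "p > 1" using prime_gt_1_nat[OF p] by auto
  show ?case
  proof (induction N rule: less_induct)
    case (less N)
    show ?case
    proof (cases "N = 0")
      case True
      then have "smooth_upto (insert p A) N = {}" by (auto simp: smooth_upto_def)
      moreover have "0 \<le> sieve_sum (insert p A) N"
        using insert.prems by (rule sieve_sum_nonneg)
      ultimately show ?thesis by simp
    next
      case False
      have "(\<Sum>n\<in>smooth_upto (insert p A) N. 1 / real n) =
          (\<Sum>n\<in>smooth_upto A N. 1 / real n) +
          1 / real p * (\<Sum>n\<in>smooth_upto (insert p A) (N div p). 1 / real n)"
        using p insert.hyps by (intro sum_smooth_insert) auto
      also have "\<dots> \<le> sieve_sum A N + 1 / real p * sieve_sum (insert p A) (N div p)"
        using False p1 A by (intro add_mono mult_left_mono insert.IH less.IH) auto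
      also have "sieve_sum (insert p A) (N div p) \<le> real p / (real p - 1) * sieve_sum A (N div p)"
        using insert.hyps p A by (intro sieve_sum_insert_le)
      also have "sieve_sum A N + 1 / real p * (real p / (real p - 1) * sieve_sum A (N div p)) =
          sieve_sum (insert p A) N"
        using insert.hyps p1 by (subst sieve_sum_insert) (auto simp: field_simps)
      finally show ?thesis using p1 by (simp add: divide_right_mono)
    qed
  qed
qed

text \<open>Every n <= Z factors over the primes up to Z, so the harmonic sum bounds the full sieve
  sum from below; removing the primes of Q costs Q/phi(Q). \<open>B\<close> may be larger than the
  set of primes of Q, so that one \<open>B\<close> serves all quotients Q/d later on.\<close>

lemma ln_le_sieve_sum:
  fixes Z Q :: nat
  defines "A \<equiv> {p. prime p \<and> p \<le> Z \<and> \<not> p dvd Q}"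
  assumes "Z \<ge> 1" "finite B" "\<And>p. p \<in> B \<Longrightarrow> prime p" "\<And>p. prime p \<Longrightarrow> p dvd Q \<Longrightarrow> p \<in> B"
  shows "ln (real Z) \<le> totient_ratio B * sieve_sum A Z"
proof -
  define C where "C = {p. prime p \<and> p \<le> Z \<and> p dvd Q}"
  have fin: "finite A" "finite C" by (auto simp: A_def C_def)
  have "ln (real Z) \<le> harm Z"
    using ln_le_harm[of Z] assms(2) by (smt (verit) ln_le_cancel_iff of_nat_0_less_iff less_eq_Suc_le One_nat_def)
  also have "\<dots> = (\<Sum>n=1..Z. 1 / real n)" by (simp add: harm_def inverse_eq_divide)
  also have "\<dots> = (\<Sum>n\<in>smooth_upto (A \<union> C) Z. 1 / real n)"
  proof (intro sum.cong)
    have "p \<le> Z" if "p dvd n" "n \<le> Z" "n > 0" for p n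
      using dvd_imp_le[OF that(1,3)] that by simp
    then show "{1..Z} = smooth_upto (A \<union> C) Z"
      by (auto simp: smooth_upto_def A_def C_def prime_factors_dvd)
  qed auto
  also have "\<dots> \<le> sieve_sum (A \<union> C) Z"
    using fin by (intro sum_inverse_smooth_le_sieve_sum) (auto simp: A_def C_def)
  also have "\<dots> \<le> totient_ratio C * sieve_sum A Z"
    using fin by (intro sieve_sum_union_le) (auto simp: A_def C_def)
  also have "\<dots> \<le> totient_ratio B * sieve_sum A Z"
    using assms by (intro mult_right_mono totient_ratio_mono sieve_sum_nonneg) (auto simp: C_def)
  finally show ?thesis .
qed

section \<open>Counting in residue classes\<close>

lemma card_residue_lessThan:
  fixes P c :: nat
  assumes "c < P"
  shows "card {j. j < N \<and> j mod P = c} = (N + (P - 1 - c)) div P"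
proof (induction N)
  case 0
  then show ?case using assms by simp
next
  case (Suc N)
  have "{j. j < Suc N \<and> j mod P = c} =
      (if N mod P = c then insert N {j. j < N \<and> j mod P = c} else {j. j < N \<and> j mod P = c})"
    by (auto simp: less_Suc_eq)
  \<comment> \<open>The shift by \<open>P - 1 - c\<close> makes the quotient increase from N to N +
    1 exactly when N itself lies in the class.\<close>
  moreover have "N mod P = c \<longleftrightarrow> P dvd Suc (N + (P - 1 - c))"
  proof -
    have "P dvd Suc (N + (P - 1 - c)) \<longleftrightarrow> P dvd N + (P - c)"
      using assms by (intro arg_cong2[where f = "(dvd)"]) auto
    also have "\<dots> \<longleftrightarrow> [N + (P - c) = c + (P - c)] (mod P)"
      using assms by (simp add: cong_def dvd_eq_mod_eq_0)
    also have "\<dots> \<longleftrightarrow> [N = c] (mod P)" by (rule cong_add_rcancel_nat)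
    finally show ?thesis using assms by (simp add: cong_def)
  qed
  ultimately show ?case using Suc by (auto simp: div_Suc dvd_eq_mod_eq_0)
qed

lemma card_residue_interval:
  fixes P c :: nat
  assumes "c < P"
  shows "\<bar>real (card {j\<in>{a..<a + X}. j mod P = c}) - real X / real P\<bar> \<le> 1"
proof -
  define u where "u = a + (P - 1 - c)"
  have "{j. j < a + X \<and> j mod P = c} = {j. j < a \<and> j mod P = c} \<union> {j\<in>{a..<a + X}. j mod P = c}"
    by auto
  then have "card {j. j < a + X \<and> j mod P = c} =
      card ({j. j < a \<and> j mod P = c} \<union> {j\<in>{a..<a + X}. j mod P = c})"
    by (rule arg_cong)
  also have "\<dots> = card {j. j < a \<and> j mod P = c} + card {j\<in>{a..<a + X}. j mod P = c}"
    by (rule card_Un_disjoint) auto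
  finally have "real (card {j\<in>{a..<a + X}. j mod P = c}) = real ((u + X) div P) - real (u div P)"
    using assms by (simp add: card_residue_lessThan u_def algebra_simps)
  also have "\<dots> = real_of_int \<lfloor>real (u + X) / real P\<rfloor> - real_of_int \<lfloor>real u / real P\<rfloor>"
    by (simp only: floor_divide_of_nat_eq of_int_of_nat_eq)
  finally have "real (card {j\<in>{a..<a + X}. j mod P = c}) =
      real_of_int \<lfloor>real u / real P + real X / real P\<rfloor> - real_of_int \<lfloor>real u / real P\<rfloor>"
    by (simp add: add_divide_distrib)
  then show ?thesis by linarith
qed

lemma card_linear_divisible:
  fixes P Q r :: nat
  assumes "coprime P Q" "P > 0"
  shows "\<bar>real (card {j\<in>{a..<a + X}. P dvd j * Q + r}) - real X / real P\<bar> \<le> 1"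
proof -
  obtain y where y: "[Q * y = 1] (mod P)"
    using cong_solve_coprime_nat[of Q P] assms by (auto simp: coprime_commute)
  \<comment> \<open>\<open>(P - 1) * r\<close> represents -r, so \<open>c0\<close> solves c0 Q + r =
    0 modulo P.\<close>
  define c0 where "c0 = y * ((P - 1) * r)"
  have c0: "[Q * c0 = (P - 1) * r] (mod P)"
    using cong_scalar_right[OF y, of "(P - 1) * r"] by (simp add: c0_def mult.assoc)
  define c where "c = c0 mod P"
  have "P dvd j * Q + r \<longleftrightarrow> j mod P = c" for j
  proof -
    have *: "[c0 * Q + r = 0] (mod P)"
    proof -
      have "[c0 * Q + r = (P - 1) * r + r] (mod P)"
        using c0 by (intro cong_add cong_refl) (simp add: mult.commute)
      also have "(P - 1) * r + r = P * r" using assms by (cases P) auto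
      finally show ?thesis by (simp add: cong_def)
    qed
    have "P dvd j * Q + r \<longleftrightarrow> [j * Q + r = c0 * Q + r] (mod P)"
      using * by (simp add: cong_def dvd_eq_mod_eq_0)
    also have "\<dots> \<longleftrightarrow> [j = c0] (mod P)"
      using assms by (simp add: cong_add_rcancel_nat cong_mult_rcancel_nat coprime_commute)
    finally show ?thesis by (simp add: cong_def c_def)
  qed
  then show ?thesis using card_residue_interval[of c P a X] assms by (simp add: c_def)
qed

lemma prime_prod_iff_mem:
  fixes B :: "nat set"
  assumes "finite B" "\<And>q. q \<in> B \<Longrightarrow> prime q" "prime p"
  shows "p dvd \<Prod>B \<longleftrightarrow> p \<in> B"
proof
  assume "p dvd \<Prod>B"
  then obtain q where "q \<in> B" "p dvd q" using assms by (auto simp: prime_dvd_prod_iff)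
  then show "p \<in> B" using assms(2)[of q] assms(3) primes_dvd_imp_eq by blast
next
  assume "p \<in> B"
  then show "p dvd \<Prod>B" using dvd_prodI[OF assms(1), of p "\<lambda>x. x"] by simp
qed

text \<open>By unique factorisation the product is injective on sets of primes. This count, squared,
  is the error term of the sieve.\<close>

lemma card_sieve_sets_le:
  assumes "finite A" "\<And>p. p \<in> A \<Longrightarrow> prime p"
  shows "card (sieve_sets A Z) \<le> Z"
proof -
  have "inj_on (\<lambda>B. \<Prod>B) (sieve_sets A Z)"
  proof (rule inj_onI)
    fix B C assume BC: "B \<in> sieve_sets A Z" "C \<in> sieve_sets A Z" "\<Prod>B = \<Prod>C"
    then have "p \<in> B \<longleftrightarrow> p \<in> C" if "p \<in> A" for p
      using assms that prime_prod_iff_mem[of B p] prime_prod_iff_mem[of C p] finite_subset[of _ A]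
      by (auto simp: sieve_sets_def subset_iff)
    then show "B = C" using BC by (auto simp: sieve_sets_def)
  qed
  moreover have "\<Prod>B > 0" if "B \<subseteq> A" for B
    using assms that by (intro prod_pos) (blast intro: prime_gt_0_nat)
  then have "(\<lambda>B. \<Prod>B) ` sieve_sets A Z \<subseteq> {1..Z}"
    by (auto simp: sieve_sets_def Suc_le_eq)
  ultimately have "card (sieve_sets A Z) \<le> card {1..Z}" by (intro card_inj_on_le) auto
  then show ?thesis by simp
qed

text \<open>Binomial expansion of the product of (-1 + 1) over E - C: Moebius inversion in the
  lattice of subsets.\<close>

lemma sum_alternating_between:
  fixes C E :: "'a set"
  assumes "finite E"
  shows "(\<Sum>B | C \<subseteq> B \<and> B \<subseteq> E. (-1 :: real) ^ card B) = (if C = E then (-1) ^ card C else 0)"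
proof (cases "C \<subseteq> E")
  case True
  have fin: "finite C" "finite (E - C)" using True assms finite_subset by auto
  have "(\<Sum>B | C \<subseteq> B \<and> B \<subseteq> E. (-1 :: real) ^ card B) = (\<Sum>F\<in>Pow (E - C). (-1) ^ card (C \<union> F))"
    using True by (intro sum.reindex_bij_witness[of _ "\<lambda>F. C \<union> F" "\<lambda>B. B - C"]) (auto simp: Un_absorb1)
  also have "\<dots> = (\<Sum>F\<in>Pow (E - C). (-1) ^ card C * ((\<Prod>p\<in>F. -1) * (\<Prod>p\<in>(E - C) - F. 1)))"
  proof (intro sum.cong refl)
    fix F assume "F \<in> Pow (E - C)"
    then have "card (C \<union> F) = card C + card F"
      using fin finite_subset[of F "E - C"] by (intro card_Un_disjoint) auto
    then show "(-1 :: real) ^ card (C \<union> F) = (-1) ^ card C * ((\<Prod>p\<in>F. -1) * (\<Prod>p\<in>(E - C) - F. 1))"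
      by (simp add: power_add)
  qed
  also have "\<dots> = (-1) ^ card C * (\<Prod>p\<in>E - C. -1 + 1)"
    by (subst prod_add[OF fin(2)]) (simp add: sum_distrib_left)
  also have "\<dots> = (if C = E then (-1) ^ card C else 0)"
    using True fin by auto
  finally show ?thesis .
next
  case False
  then have "{B. C \<subseteq> B \<and> B \<subseteq> E} = {}" by auto
  with False show ?thesis by (simp only: sum.empty) auto
qed

section \<open>Selberg's weights and their quadratic form\<close>

locale selberg =
  fixes A :: "nat set" and Z :: nat
  assumes finA: "finite A" and primeA: "\<And>p. p \<in> A \<Longrightarrow> prime p" and Z: "Z \<ge> 1"
begin

abbreviation "D \<equiv> sieve_sets A Z"

text \<open>Selberg's extremal weights lambda_d, which minimise the form in
  \<open>quadratic_form\<close> under the normalisation lambda_1 = 1; the sign is the Moebius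
  function.\<close>

definition lam :: "nat set \<Rightarrow> real" where
  "lam B = real (\<Prod>B) * (-1) ^ card B * (\<Sum>E | E \<in> D \<and> B \<subseteq> E. sieve_weight E) / sieve_sum A Z"

lemma finD: "finite D" using finA by (rule finite_sieve_sets)

lemma D_elim:
  assumes "B \<in> D"
  shows "finite B" "\<And>p. p \<in> B \<Longrightarrow> prime p" "\<Prod>B \<le> Z" "B \<subseteq> A" "\<Prod>B > 0"
proof -
  show 1: "B \<subseteq> A" and "\<Prod>B \<le> Z" using assms by (auto simp: sieve_sets_def)
  show "finite B" using 1 finA by (rule finite_subset)
  show 2: "prime p" if "p \<in> B" for p using 1 that primeA by auto
  show "\<Prod>B > 0" by (rule prod_pos) (use 2 in \<open>auto simp: prime_gt_0_nat\<close>)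
qed

lemma D_subset:
  assumes "E \<in> D" "B \<subseteq> E"
  shows "B \<in> D"
proof -
  have "\<Prod>B \<le> \<Prod>E"
    using D_elim(1,5)[OF assms(1)] assms(2) by (intro dvd_imp_le prod_dvd_prod_subset)
  then show ?thesis using assms by (auto simp: sieve_sets_def)
qed

lemma empty_in_D: "{} \<in> D" using Z by (simp add: sieve_sets_def)

lemma sum_pos: "sieve_sum A Z > 0"
  unfolding sieve_sum_def
  using D_elim by (intro ordered_comm_monoid_add_class.sum_pos finD sieve_weight_pos) (use empty_in_D in auto)

lemma lam_empty: "lam {} = 1"
  using sum_pos by (simp add: lam_def sieve_sum_def)

text \<open>Writing the supersets of \<open>B\<close> as \<open>B \<union> F\<close> splits off the
  weight of \<open>B\<close>, and \<open>\<Prod>B\<close> times that weight is d/phi(d). What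
  remains is the smaller side of \<open>sieve_sum_union_ge\<close>. Bounded weights keep the sieve
  error at one unit per pair of sets.\<close>

lemma abs_lam_le:
  assumes "B \<in> D"
  shows "\<bar>lam B\<bar> \<le> 1"
proof -
  note B = D_elim[OF assms]
  have fin: "finite F" if "F \<subseteq> A" for F using that finA finite_subset by blast
  have prod_union: "\<Prod>(B \<union> F) = \<Prod>B * \<Prod>F" if "F \<subseteq> A - B" for F
    using fin[of F] B that by (intro prod.union_disjoint) auto
  have "(\<Sum>E | E \<in> D \<and> B \<subseteq> E. sieve_weight E) =
      (\<Sum>F\<in>sieve_sets (A - B) (Z div \<Prod>B). sieve_weight (B \<union> F))"
  proof (rule sum.reindex_bij_witness[of _ "\<lambda>F. B \<union> F" "\<lambda>E. E - B"])
    fix E assume E: "E \<in> {E. E \<in> D \<and> B \<subseteq> E}"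
    then show EB: "B \<union> (E - B) = E" by auto
    have "\<Prod>E = \<Prod>B * \<Prod>(E - B)"
      using prod_union[of "E - B"] EB E by (auto simp: sieve_sets_def)
    then show "E - B \<in> sieve_sets (A - B) (Z div \<Prod>B)"
      using E B by (auto simp: sieve_sets_def less_eq_div_iff_mult_less_eq mult.commute)
    show "sieve_weight (B \<union> (E - B)) = sieve_weight E" using EB by simp
  next
    fix F assume F: "F \<in> sieve_sets (A - B) (Z div \<Prod>B)"
    then show "B \<union> F - B = F" by (auto simp: sieve_sets_def)
    show "B \<union> F \<in> {E. E \<in> D \<and> B \<subseteq> E}"
      using F B prod_union[of F]
      by (auto simp: sieve_sets_def less_eq_div_iff_mult_less_eq mult.commute)
  qed
  also have "\<dots> = (\<Sum>F\<in>sieve_sets (A - B) (Z div \<Prod>B). sieve_weight B * sieve_weight F)"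
  proof (intro sum.cong refl)
    fix F assume "F \<in> sieve_sets (A - B) (Z div \<Prod>B)"
    then have "finite F" "B \<inter> F = {}" using fin[of F] by (auto simp: sieve_sets_def)
    then show "sieve_weight (B \<union> F) = sieve_weight B * sieve_weight F"
      using B(1) unfolding sieve_weight_def by (intro prod.union_disjoint)
  qed
  finally have eq: "(\<Sum>E | E \<in> D \<and> B \<subseteq> E. sieve_weight E) =
      sieve_weight B * sieve_sum (A - B) (Z div \<Prod>B)"
    by (simp add: sieve_sum_def sum_distrib_left)
  have "real (\<Prod>B) * sieve_weight B = totient_ratio B"
    by (simp add: sieve_weight_def totient_ratio_def prod.distrib [symmetric])
  then have "real (\<Prod>B) * (\<Sum>E | E \<in> D \<and> B \<subseteq> E. sieve_weight E) =
      totient_ratio B * sieve_sum (A - B) (Z div \<Prod>B)"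
    unfolding eq by (simp add: mult.assoc [symmetric])
  also have "\<dots> \<le> sieve_sum ((A - B) \<union> B) Z"
    using finA primeA B by (intro sieve_sum_union_ge) auto
  also have "(A - B) \<union> B = A" using B by auto
  finally have le: "real (\<Prod>B) * (\<Sum>E | E \<in> D \<and> B \<subseteq> E. sieve_weight E) \<le> sieve_sum A Z" .
  have "0 \<le> (\<Sum>E | E \<in> D \<and> B \<subseteq> E. sieve_weight E)"
    using D_elim by (intro sum_nonneg less_imp_le[OF sieve_weight_pos]) auto
  then have "\<bar>lam B\<bar> = real (\<Prod>B) * (\<Sum>E | E \<in> D \<and> B \<subseteq> E. sieve_weight E) / sieve_sum A Z"
    using sum_pos by (simp add: lam_def abs_mult power_abs del: of_nat_prod)
  also have "\<dots> \<le> 1" using le sum_pos by simp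
  finally show ?thesis .
qed

text \<open>Inverts the transformation that defines \<open>lam\<close>: after interchanging the
  sums, the alternating sum over the sets between \<open>C\<close> and \<open>E\<close> leaves only
  E = C. These sums are the coordinates in which the quadratic form is diagonal.\<close>

lemma sum_lam_supersets:
  assumes "C \<in> D"
  shows "(\<Sum>B | B \<in> D \<and> C \<subseteq> B. lam B / real (\<Prod>B)) = (-1) ^ card C * sieve_weight C / sieve_sum A Z"
proof -
  have "(\<Sum>B | B \<in> D \<and> C \<subseteq> B. lam B / real (\<Prod>B)) =
      (\<Sum>B | B \<in> D \<and> C \<subseteq> B. \<Sum>E | E \<in> D \<and> B \<subseteq> E. (-1) ^ card B * sieve_weight E / sieve_sum A Z)"
  proof (intro sum.cong refl)
    fix B assume "B \<in> {B. B \<in> D \<and> C \<subseteq> B}"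
    then have "real (\<Prod>B) > 0" using D_elim(5)[of B] by (simp del: of_nat_prod)
    then have "lam B / real (\<Prod>B) =
        (-1) ^ card B * (\<Sum>E | E \<in> D \<and> B \<subseteq> E. sieve_weight E) / sieve_sum A Z"
      unfolding lam_def by (simp del: of_nat_prod)
    then show "lam B / real (\<Prod>B) =
        (\<Sum>E | E \<in> D \<and> B \<subseteq> E. (-1) ^ card B * sieve_weight E / sieve_sum A Z)"
      by (simp add: sum_distrib_left sum_divide_distrib del: of_nat_prod)
  qed
  also have "\<dots> = (\<Sum>E\<in>D. \<Sum>B | B \<in> D \<and> C \<subseteq> B \<and> B \<subseteq> E. (-1) ^ card B * sieve_weight E / sieve_sum A Z)"
    using finD by (subst sum.swap_restrict) (auto intro!: sum.cong simp: conj_ac)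
  also have "\<dots> = (\<Sum>E\<in>D. (\<Sum>B | C \<subseteq> B \<and> B \<subseteq> E. (-1) ^ card B) * (sieve_weight E / sieve_sum A Z))"
  proof (intro sum.cong refl)
    fix E assume "E \<in> D"
    then have "{B. B \<in> D \<and> C \<subseteq> B \<and> B \<subseteq> E} = {B. C \<subseteq> B \<and> B \<subseteq> E}"
      using D_subset by blast
    then show "(\<Sum>B | B \<in> D \<and> C \<subseteq> B \<and> B \<subseteq> E. (-1) ^ card B * sieve_weight E / sieve_sum A Z) =
        (\<Sum>B | C \<subseteq> B \<and> B \<subseteq> E. (-1) ^ card B) * (sieve_weight E / sieve_sum A Z)"
      by (simp add: sum_distrib_right sum_divide_distrib)
  qed
  also have "\<dots> = (\<Sum>E\<in>D. (if C = E then (-1) ^ card C else 0) * (sieve_weight E / sieve_sum A Z))"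
    using D_elim(1) by (intro sum.cong refl) (simp add: sum_alternating_between)
  also have "\<dots> = (\<Sum>E\<in>D. if C = E then (-1) ^ card C * (sieve_weight E / sieve_sum A Z) else 0)"
    by (intro sum.cong) auto
  also have "\<dots> = (-1) ^ card C * sieve_weight C / sieve_sum A Z"
    using assms finD by (subst sum.delta') auto
  finally show ?thesis .
qed

text \<open>The quadratic form is diagonalised by writing the greatest common divisor as
  $\sum_{d \mid (m,n)} \varphi(d)$.\<close>

lemma quadratic_form:
  "(\<Sum>B\<in>D. \<Sum>C\<in>D. lam B * lam C / real (\<Prod>(B \<union> C))) = 1 / sieve_sum A Z"
proof -
  define u where "u B = lam B / real (\<Prod>B)" for B
  define \<phi> where "\<phi> E = (\<Prod>p\<in>E. real p - 1)" for E :: "nat set"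
  have prod_Int: "real (\<Prod>(B \<inter> C)) = (\<Sum>E | E \<in> D \<and> E \<subseteq> B \<and> E \<subseteq> C. \<phi> E)" if "B \<in> D" "C \<in> D" for B C
  proof -
    have fin: "finite (B \<inter> C)" using D_elim(1)[OF that(1)] by simp
    have "real (\<Prod>(B \<inter> C)) = (\<Prod>p\<in>B \<inter> C. (real p - 1) + 1)" by simp
    also have "\<dots> = (\<Sum>E\<in>Pow (B \<inter> C). \<phi> E)"
      by (subst prod_add[OF fin]) (simp add: \<phi>_def)
    also have "Pow (B \<inter> C) = {E. E \<in> D \<and> E \<subseteq> B \<and> E \<subseteq> C}"
      using that D_subset by auto
    finally show ?thesis .
  qed
  have "lam B * lam C / real (\<Prod>(B \<union> C)) = u B * u C * real (\<Prod>(B \<inter> C))"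
    if "B \<in> D" "C \<in> D" for B C
  proof -
    note BC = D_elim[OF that(1)] D_elim[OF that(2)]
    have "real (\<Prod>(B \<union> C)) * real (\<Prod>(B \<inter> C)) = real (\<Prod>B) * real (\<Prod>C)"
      using prod.union_inter[of B C "\<lambda>x. x"] BC by (metis of_nat_mult)
    moreover have "\<Prod>(B \<union> C) > 0" using BC by (intro prod_pos) (auto simp: prime_gt_0_nat)
    ultimately show ?thesis using BC by (simp add: u_def divide_simps mult_ac del: of_nat_prod)
  qed
  then have "(\<Sum>B\<in>D. \<Sum>C\<in>D. lam B * lam C / real (\<Prod>(B \<union> C))) =
      (\<Sum>B\<in>D. \<Sum>C\<in>D. u B * u C * (\<Sum>E | E \<in> D \<and> E \<subseteq> B \<and> E \<subseteq> C. \<phi> E))"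
    by (intro sum.cong refl) (simp only: prod_Int)
  also have "\<dots> = (\<Sum>B\<in>D. \<Sum>C\<in>D. \<Sum>E\<in>D. (if E \<subseteq> B then u B else 0) * (if E \<subseteq> C then u C else 0) * \<phi> E)"
  proof (intro sum.cong refl)
    fix B C
    have "(\<Sum>E | E \<in> D \<and> E \<subseteq> B \<and> E \<subseteq> C. \<phi> E) =
        (\<Sum>E\<in>D. if E \<subseteq> B \<and> E \<subseteq> C then \<phi> E else 0)"
      by (rule sum.inter_filter[OF finD])
    then show "u B * u C * (\<Sum>E | E \<in> D \<and> E \<subseteq> B \<and> E \<subseteq> C. \<phi> E) =
        (\<Sum>E\<in>D. (if E \<subseteq> B then u B else 0) * (if E \<subseteq> C then u C else 0) * \<phi> E)"
      by (simp add: sum_distrib_left) (intro sum.cong refl, simp)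
  qed
  also have "\<dots> = (\<Sum>B\<in>D. \<Sum>E\<in>D. \<Sum>C\<in>D. (if E \<subseteq> B then u B else 0) * (if E \<subseteq> C then u C else 0) * \<phi> E)"
    by (intro sum.cong refl sum.swap)
  also have "\<dots> = (\<Sum>E\<in>D. \<Sum>B\<in>D. \<Sum>C\<in>D. (if E \<subseteq> B then u B else 0) * (if E \<subseteq> C then u C else 0) * \<phi> E)"
    by (rule sum.swap)
  also have "\<dots> = (\<Sum>E\<in>D. \<phi> E * (\<Sum>B\<in>D. if E \<subseteq> B then u B else 0)\<^sup>2)"
    by (simp add: power2_eq_square sum_product sum_distrib_left mult_ac)
  also have "\<dots> = (\<Sum>E\<in>D. \<phi> E * ((-1) ^ card E * sieve_weight E / sieve_sum A Z)\<^sup>2)"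
  proof (intro sum.cong refl)
    fix E assume E: "E \<in> D"
    have "(\<Sum>B\<in>D. if E \<subseteq> B then u B else 0) = (\<Sum>B | B \<in> D \<and> E \<subseteq> B. u B)"
      using finD by (simp add: sum.inter_filter)
    also have "\<dots> = (-1) ^ card E * sieve_weight E / sieve_sum A Z"
      unfolding u_def using E by (rule sum_lam_supersets)
    finally show "\<phi> E * (\<Sum>B\<in>D. if E \<subseteq> B then u B else 0)\<^sup>2 =
        \<phi> E * ((-1) ^ card E * sieve_weight E / sieve_sum A Z)\<^sup>2" by simp
  qed
  also have "\<dots> = (\<Sum>E\<in>D. sieve_weight E / (sieve_sum A Z)\<^sup>2)"
  proof (intro sum.cong refl)
    fix E assume E: "E \<in> D"
    have "\<phi> E * sieve_weight E = (\<Prod>p\<in>E. (real p - 1) * (1 / (real p - 1)))"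
      by (simp add: \<phi>_def sieve_weight_def prod.distrib [symmetric])
    also have "\<dots> = (\<Prod>p\<in>E. 1)"
      using D_elim(2)[OF E] prime_real_gt_1 by (intro prod.cong refl) force
    finally have *: "\<phi> E * sieve_weight E = 1" by simp
    have "((-1 :: real) ^ card E)\<^sup>2 = 1" by (simp flip: power_mult)
    then have "\<phi> E * ((-1) ^ card E * sieve_weight E / sieve_sum A Z)\<^sup>2 =
        (\<phi> E * sieve_weight E) * sieve_weight E / (sieve_sum A Z)\<^sup>2"
      by (simp add: power_mult_distrib power_divide power2_eq_square[of "sieve_weight E"])
    then show "\<phi> E * ((-1) ^ card E * sieve_weight E / sieve_sum A Z)\<^sup>2 = sieve_weight E / (sieve_sum A Z)\<^sup>2"
      by (simp add: *)
  qed
  also have "\<dots> = 1 / sieve_sum A Z"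
    using sum_pos by (simp add: sum_divide_distrib [symmetric] sieve_sum_def [symmetric] power2_eq_square)
  finally show ?thesis .
qed

text \<open>The square of the sum of lambda_d over the d dividing a value is 1 if no prime of
  \<open>A\<close> divides the value, and nonnegative otherwise. After expanding and counting the
  multiples of each lcm, the main terms make up the quadratic form and each pair adds at most 1 to
  the error.\<close>

theorem selberg_sieve:
  assumes cop: "\<And>p. p \<in> A \<Longrightarrow> \<not> p dvd Q"
  shows "real (card {j\<in>{a..<a + X}. \<forall>p\<in>A. \<not> p dvd j * Q + r}) \<le> real X / sieve_sum A Z + (real Z)\<^sup>2"
proof -
  define J where "J = {a..<a + X}"
  define v where "v j = j * Q + r" for j
  define N where "N B = real (card {j\<in>J. \<Prod>B dvd v j})" for B
  have finJ: "finite J" by (simp add: J_def)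
  have dvd_iff: "\<Prod>B dvd n \<longleftrightarrow> (\<forall>p\<in>B. p dvd n)" if "B \<subseteq> A" for B n
  proof (intro iffI ballI)
    have finB: "finite B" using that finA by (rule finite_subset)
    show "p dvd n" if "\<Prod>B dvd n" "p \<in> B" for p
      using dvd_trans[OF dvd_prodI[OF finB, of p "\<lambda>x. x"]] that by simp
    show "\<Prod>B dvd n" if "\<forall>p\<in>B. p dvd n"
      using finB \<open>B \<subseteq> A\<close> primeA that by (intro primes_dvd_imp_prod_dvd) auto
  qed
  have "real (card {j\<in>J. \<forall>p\<in>A. \<not> p dvd v j}) = (\<Sum>j\<in>J. if \<forall>p\<in>A. \<not> p dvd v j then 1 else 0)"
    using finJ by (simp add: sum.inter_filter [symmetric])
  also have "\<dots> \<le> (\<Sum>j\<in>J. (\<Sum>B\<in>D. if \<Prod>B dvd v j then lam B else 0)\<^sup>2)"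
  proof (rule sum_mono)
    fix j
    show "(if \<forall>p\<in>A. \<not> p dvd v j then 1 else 0) \<le> (\<Sum>B\<in>D. if \<Prod>B dvd v j then lam B else 0)\<^sup>2"
    proof (cases "\<forall>p\<in>A. \<not> p dvd v j")
      case True
      have "(\<Sum>B\<in>D. if \<Prod>B dvd v j then lam B else 0) = (\<Sum>B\<in>{{}}. lam B)"
        using True finD empty_in_D D_elim(4) dvd_iff
        by (intro sum.mono_neutral_cong_right) (auto, blast)
      then show ?thesis by (simp add: lam_empty)
    next
      case False
      then show ?thesis by (simp only: if_False zero_le_power2)
    qed
  qed
  also have "\<dots> = (\<Sum>j\<in>J. \<Sum>B\<in>D. \<Sum>C\<in>D. lam B * lam C * (if \<Prod>(B \<union> C) dvd v j then 1 else 0))"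
  proof (intro sum.cong refl)
    fix j
    have "(if \<Prod>B dvd v j then lam B else 0) * (if \<Prod>C dvd v j then lam C else 0) =
        lam B * lam C * (if \<Prod>(B \<union> C) dvd v j then 1 else 0)" if "B \<in> D" "C \<in> D" for B C
      using D_elim(4)[OF that(1)] D_elim(4)[OF that(2)] by (auto simp: dvd_iff)
    then show "(\<Sum>B\<in>D. if \<Prod>B dvd v j then lam B else 0)\<^sup>2 =
        (\<Sum>B\<in>D. \<Sum>C\<in>D. lam B * lam C * (if \<Prod>(B \<union> C) dvd v j then 1 else 0))"
      unfolding power2_eq_square sum_product by (intro sum.cong refl) blast
  qed
  also have "\<dots> = (\<Sum>B\<in>D. \<Sum>C\<in>D. \<Sum>j\<in>J. lam B * lam C * (if \<Prod>(B \<union> C) dvd v j then 1 else 0))"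
    by (subst sum.swap, intro sum.cong refl, rule sum.swap)
  also have "\<dots> = (\<Sum>B\<in>D. \<Sum>C\<in>D. lam B * lam C * N (B \<union> C))"
    using finJ by (simp add: N_def sum_distrib_left [symmetric] sum.inter_filter [symmetric])
  also have "\<dots> \<le> (\<Sum>B\<in>D. \<Sum>C\<in>D. real X * (lam B * lam C / real (\<Prod>(B \<union> C))) + 1)"
  proof (intro sum_mono)
    fix B C assume BC: "B \<in> D" "C \<in> D"
    note BC' = D_elim[OF BC(1)] D_elim[OF BC(2)]
    have "coprime (\<Prod>(B \<union> C)) Q"
      using BC' cop primeA by (intro prod_coprime_left) (auto intro!: prime_imp_coprime)
    moreover have "\<Prod>(B \<union> C) > 0" using BC' by (intro prod_pos) (auto simp: prime_gt_0_nat)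
    ultimately have "\<bar>N (B \<union> C) - real X / real (\<Prod>(B \<union> C))\<bar> \<le> 1"
      unfolding N_def J_def v_def by (rule card_linear_divisible)
    moreover have "\<bar>lam B * lam C\<bar> \<le> 1"
      using abs_lam_le[OF BC(1)] abs_lam_le[OF BC(2)] by (simp add: abs_mult mult_le_one)
    ultimately have "\<bar>lam B * lam C * (N (B \<union> C) - real X / real (\<Prod>(B \<union> C)))\<bar> \<le> 1"
      by (simp add: abs_mult mult_le_one)
    then show "lam B * lam C * N (B \<union> C) \<le> real X * (lam B * lam C / real (\<Prod>(B \<union> C))) + 1"
      by (simp add: algebra_simps del: of_nat_prod)
  qed
  also have "\<dots> = real X * (\<Sum>B\<in>D. \<Sum>C\<in>D. lam B * lam C / real (\<Prod>(B \<union> C))) + (real (card D))\<^sup>2"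
    by (simp add: sum.distrib sum_distrib_left power2_eq_square del: of_nat_prod)
  also have "\<dots> = real X / sieve_sum A Z + (real (card D))\<^sup>2"
    by (simp only: quadratic_form) simp
  also have "(real (card D))\<^sup>2 \<le> (real Z)\<^sup>2"
    using card_sieve_sets_le[OF finA primeA, of Z] by (intro power_mono) auto
  finally show ?thesis by (simp add: J_def v_def)
qed

end

text \<open>A prime value divisible by some p in \<open>A\<close> equals p <= Z; as Q >= 1 this
  allows at most Z + 1 values of j, which the second Z^2 absorbs. The classical constant 2 appears
  once Z is chosen near the square root of X.\<close>

theorem brun_titchmarsh:
  assumes Z2: "Z \<ge> 2" and Q: "Q > 0"
    and B: "finite B" "\<And>p. p \<in> B \<Longrightarrow> prime p" "\<And>p. prime p \<Longrightarrow> p dvd Q \<Longrightarrow> p \<in> B"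
  shows "real (card {j\<in>{a..<a + X}. prime (j * Q + r)}) \<le>
    real X * totient_ratio B / ln (real Z) + 2 * (real Z)\<^sup>2"
proof -
  define A where "A = {p. prime p \<and> p \<le> Z \<and> \<not> p dvd Q}"
  interpret selberg A Z
    using Z2 by unfold_locales (auto simp: A_def)
  have "{j\<in>{a..<a + X}. prime (j * Q + r)} \<subseteq> {j\<in>{a..<a + X}. \<forall>p\<in>A. \<not> p dvd j * Q + r} \<union> {..Z}"
  proof
    fix j assume j: "j \<in> {j\<in>{a..<a + X}. prime (j * Q + r)}"
    show "j \<in> {j\<in>{a..<a + X}. \<forall>p\<in>A. \<not> p dvd j * Q + r} \<union> {..Z}"
    proof (cases "\<exists>p\<in>A. p dvd j * Q + r")
      case True
      then obtain p where "p \<in> A" "p dvd j * Q + r" by blast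
      then have "p = j * Q + r" using j by (intro primes_dvd_imp_eq) (auto simp: A_def)
      then have "j * Q + r \<le> Z" using \<open>p \<in> A\<close> by (simp add: A_def)
      moreover have "j \<le> j * Q" using Q by simp
      ultimately have "j \<le> Z" by linarith
      then show ?thesis by simp
    qed (use j in auto)
  qed
  then have "card {j\<in>{a..<a + X}. prime (j * Q + r)} \<le>
      card ({j\<in>{a..<a + X}. \<forall>p\<in>A. \<not> p dvd j * Q + r} \<union> {..Z})"
    by (intro card_mono) auto
  also have "\<dots> \<le> card {j\<in>{a..<a + X}. \<forall>p\<in>A. \<not> p dvd j * Q + r} + card {..Z}"
    by (rule card_Un_le)
  finally have "real (card {j\<in>{a..<a + X}. prime (j * Q + r)}) \<le>
      real (card {j\<in>{a..<a + X}. \<forall>p\<in>A. \<not> p dvd j * Q + r}) + (real Z + 1)"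
    by simp
  also have "real (card {j\<in>{a..<a + X}. \<forall>p\<in>A. \<not> p dvd j * Q + r}) \<le>
      real X / sieve_sum A Z + (real Z)\<^sup>2"
    by (rule selberg_sieve) (simp add: A_def)
  also have "real X / sieve_sum A Z \<le> real X * totient_ratio B / ln (real Z)"
  proof -
    have "ln (real Z) \<le> totient_ratio B * sieve_sum A Z"
      unfolding A_def using Z2 B by (intro ln_le_sieve_sum) auto
    then have "1 / sieve_sum A Z \<le> totient_ratio B / ln (real Z)"
      using Z2 sum_pos by (simp add: field_simps)
    from mult_left_mono[OF this, of "real X"] show ?thesis by simp
  qed
  also have "real Z + 1 \<le> (real Z)\<^sup>2"
  proof -
    have "2 * real Z \<le> real Z * real Z" using Z2 by (intro mult_right_mono) auto
    moreover have "real Z \<ge> 2" using Z2 by simp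
    ultimately show ?thesis unfolding power2_eq_square by linarith
  qed
  finally show ?thesis by simp
qed

section \<open>Smooth numbers\<close>

text \<open>Enlarging \<open>N div p\<close> to \<open>N\<close> in the recursion gives F <= product
  + g(p) F for the finite sum F, and this is solved for F.\<close>

lemma sum_smooth_le_euler_product:
  fixes g :: "nat \<Rightarrow> real"
  assumes "finite A" "\<And>p. p \<in> A \<Longrightarrow> prime p"
    and mult: "\<And>m n. g (m * n) = g m * g n" and nonneg: "\<And>n. g n \<ge> 0" and "g 1 \<le> 1"
    and less: "\<And>p. p \<in> A \<Longrightarrow> g p < 1"
  shows "(\<Sum>n\<in>smooth_upto A N. g n) \<le> (\<Prod>p\<in>A. 1 / (1 - g p))"
  using assms(1,2) less
proof (induction A arbitrary: N rule: finite_induct)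
  case empty
  have "(\<Sum>n\<in>smooth_upto {} N. g n) \<le> (\<Sum>n\<in>{1}. g n)"
    by (intro sum_mono2) (auto simp: smooth_upto_def prime_factorization_empty_iff nonneg)
  then show ?case using \<open>g 1 \<le> 1\<close> by simp
next
  case (insert p A)
  define F where "F = (\<Sum>n\<in>smooth_upto (insert p A) N. g n)"
  have p: "prime p" and gp: "g p < 1" using insert.prems by auto
  have "F = (\<Sum>n\<in>smooth_upto A N. g n) + g p * (\<Sum>n\<in>smooth_upto (insert p A) (N div p). g n)"
    unfolding F_def using p insert.hyps mult by (intro sum_smooth_insert) auto
  also have "(\<Sum>n\<in>smooth_upto (insert p A) (N div p). g n) \<le> F"
    unfolding F_def using nonneg
    by (intro sum_mono2) (auto simp: smooth_upto_def intro: order_trans[OF _ div_le_dividend])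
  also have "(\<Sum>n\<in>smooth_upto A N. g n) \<le> (\<Prod>p\<in>A. 1 / (1 - g p))"
    using insert.prems by (intro insert.IH) auto
  finally have "F \<le> (\<Prod>p\<in>A. 1 / (1 - g p)) + g p * F" using nonneg by (simp add: mult_left_mono)
  then have "F \<le> 1 / (1 - g p) * (\<Prod>p\<in>A. 1 / (1 - g p))"
    using gp by (simp add: field_simps)
  then show ?case using insert.hyps by (simp add: F_def)
qed

text \<open>The threshold 2/3 is the bound that \<open>two_powr_le\<close> yields for p^(delta - 1)
  when p >= 2 and delta <= 1/4; it makes 1/(1 - q) at most 3.\<close>

lemma inverse_one_minus_le_exp:
  fixes q :: real
  assumes "0 \<le> q" "q \<le> 2 / 3"
  shows "1 / (1 - q) \<le> exp (q + 3 * q\<^sup>2)"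
proof -
  have "1 / (1 - q) = 1 + (q + q\<^sup>2 * (1 / (1 - q)))"
    using assms by (simp add: divide_simps) (simp add: algebra_simps power2_eq_square)
  also have "\<dots> \<le> exp (q + q\<^sup>2 * (1 / (1 - q)))" by (rule exp_ge_add_one_self)
  also have "1 / (1 - q) \<le> 3" using assms by (simp add: field_simps)
  then have "exp (q + q\<^sup>2 * (1 / (1 - q))) \<le> exp (q + q\<^sup>2 * 3)"
    by (intro exp_le_cancel_iff [THEN iffD2] add_left_mono mult_left_mono) auto
  finally show ?thesis by (simp add: mult.commute)
qed

text \<open>The chord of the convex function t -> y^t over [0, 1]. With \<theta> = ln p / ln z it
  makes p^delta linear in ln p, so that Mertens's first estimate can sum it.\<close>

lemma powr_le_one_plus:
  fixes y \<theta> :: real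
  assumes "y > 0" "0 \<le> \<theta>" "\<theta> \<le> 1"
  shows "y powr \<theta> \<le> 1 + \<theta> * y"
proof -
  have "y powr \<theta> \<le> (1 - \<theta>) * 1 + \<theta> * y"
    using convex_onD[OF exp_convex, of \<theta> 0 "ln y"] assms by (simp add: powr_def)
  then show ?thesis using assms by simp
qed

lemma sum_ln_over_primes_le:
  assumes "z \<ge> 1"
  shows "(\<Sum>p\<in>primes_in 0 z. ln (real p) / real p) \<le> ln z + ln 4"
proof -
  define n where "n = nat \<lfloor>z\<rfloor>"
  have n: "n \<ge> 1" "real n \<le> z" using assms by (auto simp: n_def le_nat_iff le_floor_iff)
  have "(\<Sum>p\<in>primes_in 0 z. ln (real p) / real p) = (\<Sum>p\<in>primes_in 0 n. ln (real p) / real p)"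
    unfolding n_def using assms by (subst primes_in_floor) auto
  also have "\<dots> \<le> ln (real n) + ln 4" using n(1) by (rule mertens1_upper)
  also have "ln (real n) \<le> ln z" using n by simp
  finally show ?thesis by simp
qed

lemma sum_inverse_primes_upto_le:
  assumes "z \<ge> 2"
  shows "(\<Sum>p\<in>primes_in 0 z. 1 / real p) \<le> ln (ln z) + (1 / 2 - ln (ln 2) + 13 / ln 2)"
proof -
  have "(\<Sum>p\<in>primes_in 0 z. 1 / real p) \<le> (\<Sum>p\<in>insert 2 (primes_in 2 z). 1 / real p)"
  proof (intro sum_mono2)
    show "primes_in 0 z \<subseteq> insert 2 (primes_in 2 z)"
    proof
      fix p assume "p \<in> primes_in 0 z"
      then show "p \<in> insert 2 (primes_in 2 z)"
        using prime_ge_2_nat[of p] by (cases "p = 2") (auto simp: primes_in_def)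
    qed
  qed auto
  also have "\<dots> = 1 / 2 + (\<Sum>p\<in>primes_in 2 z. 1 / real p)"
  proof -
    have "2 \<notin> primes_in 2 z" by (simp add: primes_in_def)
    then show ?thesis by simp
  qed
  also have "(\<Sum>p\<in>primes_in 2 z. 1 / real p) \<le> ln (ln z) - ln (ln 2) + 13 / ln 2"
    using assms by (intro sum_inverse_primes_le) auto
  finally show ?thesis by simp
qed

lemma two_powr_le: "2 powr (-(3 / 4)) \<le> (2 / 3 :: real)"
proof -
  have "(3 / 2 :: real) = (81 / 16) powr (1 / 4)"
    using powr_powr[of "3 / 2 :: real" 4 "1 / 4"] by (simp add: power4_eq_xxxx)
  also have "\<dots> \<le> 8 powr (1 / 4)" by (intro powr_mono2) auto
  also have "\<dots> = 2 powr (3 / 4)"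
    using powr_powr[of "2 :: real" 3 "1 / 4"] by simp
  finally have "(3 / 2 :: real) \<le> 2 powr (3 / 4)" .
  then show ?thesis by (simp add: powr_minus field_simps)
qed

text \<open>Rankin's trick with z^delta = y. By the chord bound the sum of p^(delta - 1) over p <= z
  is at most the sum of 1/p, responsible for the factor ln z, plus y / ln z times the sum of ln p /
  p, responsible for exp(3 y). The hypothesis 4 ln y <= ln z says delta <= 1/4, so the squares are
  dominated by n^(-3/2).\<close>

theorem card_smooth_le:
  "\<exists>C>0. \<forall>z y h. z \<ge> 2 \<longrightarrow> y \<ge> 1 \<longrightarrow> 4 * ln y \<le> ln z \<longrightarrow> h \<ge> 1 \<longrightarrow>
     real (card (smooth_upto (primes_in 0 z) h)) \<le>
     C * real h * exp (- (ln y / ln z * ln (real h))) * ln z * exp (3 * y)"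
proof -
  have summ: "summable (\<lambda>n. real n powr (-3 / 2))" by (simp add: summable_real_powr_iff)
  define C1 where "C1 = (\<Sum>n. real n powr (-3 / 2))"
  define C2 where "C2 = 1 / 2 - ln (ln 2) + 13 / ln 2 + 3 * C1"
  show ?thesis
  proof (intro exI[of _ "exp C2"] conjI allI impI)
    fix z y :: real and h :: nat
    assume z: "z \<ge> 2" and y: "y \<ge> 1" and yz: "4 * ln y \<le> ln z" and h: "h \<ge> 1"
    define \<delta> where "\<delta> = ln y / ln z"
    define P where "P = primes_in 0 z"
    define q where "q n = real n powr (\<delta> - 1)" for n
    have lz: "ln z > 0" using z by simp
    have \<delta>: "0 \<le> \<delta>" "\<delta> \<le> 1 / 4" using y yz lz by (auto simp: \<delta>_def field_simps)
    have P: "prime p" "real p \<ge> 2" "real p \<le> z" if "p \<in> P" for p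
      using that prime_ge_2_nat[of p] by (auto simp: P_def primes_in_def)
    have q_le: "q p \<le> 2 / 3" if "p \<in> P" for p
    proof -
      have "q p \<le> real p powr (-(3 / 4))"
        unfolding q_def using P[OF that] \<delta> by (intro powr_mono) auto
      also have "\<dots> \<le> 2 powr (-(3 / 4))" using P[OF that] by (intro powr_mono2') auto
      finally show ?thesis using two_powr_le by linarith
    qed
    have q2: "(\<Sum>p\<in>P. (q p)\<^sup>2) \<le> C1"
    proof -
      have "(\<Sum>p\<in>P. (q p)\<^sup>2) \<le> (\<Sum>p\<in>P. real p powr (-3 / 2))"
      proof (rule sum_mono)
        fix p assume p: "p \<in> P"
        have "(q p)\<^sup>2 = real p powr (2 * (\<delta> - 1))"
          using P[OF p] by (simp add: q_def power2_eq_square powr_add [symmetric])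
        also have "\<dots> \<le> real p powr (-3 / 2)" using P[OF p] \<delta> by (intro powr_mono) auto
        finally show "(q p)\<^sup>2 \<le> real p powr (-3 / 2)" .
      qed
      also have "\<dots> \<le> C1" unfolding C1_def P_def by (intro sum_le_suminf summ) auto
      finally show ?thesis .
    qed
    have q1: "(\<Sum>p\<in>P. q p) \<le> ln (ln z) + (1 / 2 - ln (ln 2) + 13 / ln 2) + 3 * y"
    proof -
      have "(\<Sum>p\<in>P. q p) \<le> (\<Sum>p\<in>P. 1 / real p + y / ln z * (ln (real p) / real p))"
      proof (rule sum_mono)
        fix p assume p: "p \<in> P"
        note p' = P[OF p]
        have "q p = real p powr \<delta> / real p"
          using p' by (simp add: q_def powr_diff)
        also have "real p powr \<delta> = y powr (ln (real p) / ln z)"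
          using p' y by (simp add: powr_def \<delta>_def)
        also have "\<dots> \<le> 1 + (ln (real p) / ln z) * y"
          using p' y z by (intro powr_le_one_plus) auto
        finally show "q p \<le> 1 / real p + y / ln z * (ln (real p) / real p)"
          using p' by (simp add: divide_right_mono add_divide_distrib mult_ac)
      qed
      also have "\<dots> = (\<Sum>p\<in>P. 1 / real p) + y / ln z * (\<Sum>p\<in>P. ln (real p) / real p)"
        by (simp add: sum.distrib sum_distrib_left)
      also have "\<dots> \<le> (ln (ln z) + (1 / 2 - ln (ln 2) + 13 / ln 2)) + y / ln z * (ln z + ln 4)"
        unfolding P_def using z y lz
        by (intro add_mono mult_left_mono sum_inverse_primes_upto_le sum_ln_over_primes_le) auto
      also have "y / ln z * (ln z + ln 4) \<le> y / ln z * (3 * ln z)"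
      proof (rule mult_left_mono)
        have "ln (4 :: real) = 2 * ln 2" using ln_realpow[of 2 2] by simp
        also have "\<dots> \<le> 2 * ln z" using z by simp
        finally show "ln z + ln 4 \<le> 3 * ln z" by simp
      qed (use y lz in auto)
      also have "\<dots> = 3 * y" using lz by simp
      finally show ?thesis by simp
    qed
    have "real (card (smooth_upto P h)) = (\<Sum>n\<in>smooth_upto P h. 1)" by simp
    also have "\<dots> \<le> (\<Sum>n\<in>smooth_upto P h. real h powr (1 - \<delta>) * q n)"
    proof (rule sum_mono)
      fix n assume "n \<in> smooth_upto P h"
      then have n: "1 \<le> n" "n \<le> h" by (auto simp: smooth_upto_def)
      have "1 = real n powr (1 - \<delta>) * q n" using n by (simp add: q_def powr_add [symmetric])
      also have "\<dots> \<le> real h powr (1 - \<delta>) * q n"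
        using n \<delta> by (intro mult_right_mono powr_mono2) (auto simp: q_def)
      finally show "1 \<le> real h powr (1 - \<delta>) * q n" .
    qed
    also have "\<dots> = real h powr (1 - \<delta>) * (\<Sum>n\<in>smooth_upto P h. q n)"
      by (simp add: sum_distrib_left)
    also have "(\<Sum>n\<in>smooth_upto P h. q n) \<le> (\<Prod>p\<in>P. 1 / (1 - q p))"
    proof (rule sum_smooth_le_euler_product)
      show "q p < 1" if "p \<in> P" for p using q_le[OF that] by simp
    qed (use P(1) in \<open>auto simp: P_def q_def powr_mult\<close>)
    also have "\<dots> \<le> (\<Prod>p\<in>P. exp (q p + 3 * (q p)\<^sup>2))"
      using q_le by (intro prod_mono conjI inverse_one_minus_le_exp) (force simp: q_def)+
    also have "\<dots> = exp ((\<Sum>p\<in>P. q p) + 3 * (\<Sum>p\<in>P. (q p)\<^sup>2))"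
      by (simp add: exp_sum [symmetric] P_def sum.distrib sum_distrib_left)
    also have "\<dots> \<le> exp (ln (ln z) + C2 + 3 * y)"
      using q1 q2 by (simp add: C2_def)
    also have "\<dots> = ln z * exp C2 * exp (3 * y)" using lz by (simp add: exp_add)
    finally have "real (card (smooth_upto P h)) \<le> real h powr (1 - \<delta>) * (ln z * exp C2 * exp (3 * y))"
      by (simp add: mult_left_mono)
    also have "real h powr (1 - \<delta>) = real h * exp (- (\<delta> * ln (real h)))"
      using h by (simp add: powr_def left_diff_distrib exp_diff exp_minus divide_inverse)
    finally show "real (card (smooth_upto (primes_in 0 z) h)) \<le>
        exp C2 * real h * exp (- (ln y / ln z * ln (real h))) * ln z * exp (3 * y)"
      by (simp add: P_def \<delta>_def mult_ac)
  qed auto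
qed

section \<open>Products of primes in an interval\<close>

lemma sum_consecutive_inverse_le:
  fixes a b :: nat
  assumes "a \<ge> 1" "a \<le> b"
  shows "(\<Sum>n\<in>{a<..b}. 1 / (real n * (real n - 1))) \<le> 1 / real a - 1 / real b"
  using assms(2)
proof (induction b rule: dec_induct)
  case (step n)
  have "{a<..Suc n} = insert (Suc n) {a<..n}" using step by auto
  then have "(\<Sum>m\<in>{a<..Suc n}. 1 / (real m * (real m - 1))) \<le>
      1 / (real (Suc n) * real n) + (1 / real a - 1 / real n)"
    using step.IH by simp
  also have "1 / (real (Suc n) * real n) = 1 / real n - 1 / real (Suc n)"
    using step(1) assms(1) by (simp add: divide_simps)
  also have "1 / real n - 1 / real (Suc n) + (1 / real a - 1 / real n) = 1 / real a - 1 / real (Suc n)"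
    by simp
  finally show ?case .
qed simp

lemma sum_primes_consecutive_le:
  assumes "z \<ge> 2"
  shows "(\<Sum>p\<in>primes_in z x. 1 / (real p * (real p - 1))) \<le> 2 / z"
proof (cases "x \<ge> z")
  case True
  define a where "a = nat \<lfloor>z\<rfloor>"
  define b where "b = nat \<lfloor>x\<rfloor>"
  have ab: "a \<ge> 2" "z \<le> real a + 1"
    using assms by (auto simp: a_def le_nat_iff le_floor_iff)
  have ab': "a \<le> b" unfolding a_def b_def using True by (intro nat_mono floor_mono)
  have "(\<Sum>p\<in>primes_in z x. 1 / (real p * (real p - 1))) \<le>
      (\<Sum>n\<in>{a<..b}. 1 / (real n * (real n - 1)))"
  proof (rule sum_mono2)
    show "primes_in z x \<subseteq> {a<..b}"
      using assms True by (auto simp: primes_in_def a_def b_def le_nat_floor) linarith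
  qed (use ab ab' in auto)
  also have "\<dots> \<le> 1 / real a - 1 / real b"
    using ab ab' by (intro sum_consecutive_inverse_le) auto
  also have "\<dots> \<le> 1 / real a" by simp
  also have "\<dots> \<le> 2 / z" using ab assms by (simp add: field_simps)
  finally show ?thesis .
next
  case False
  then have "primes_in z x = {}" by (auto simp: primes_in_def)
  then show ?thesis using assms by simp
qed

text \<open>In p/(p - 1) = 1 + 1/p + 1/(p(p - 1)) the term 1/p gives ln x / ln z by Mertens; the
  exponential factor tends to 1 as z grows.\<close>

lemma totient_ratio_primes_in_le:
  assumes "2 \<le> z" "z \<le> x"
  shows "totient_ratio (primes_in z x) \<le> ln x / ln z * exp (13 / ln z + 2 / z)"
proof -
  have lz: "ln z > 0" "ln x > 0" using assms by auto
  have "totient_ratio (primes_in z x) \<le> (\<Prod>p\<in>primes_in z x. exp (1 / real p + 1 / (real p * (real p - 1))))"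
    unfolding totient_ratio_def
  proof (rule prod_mono)
    fix p assume "p \<in> primes_in z x"
    then have p: "real p > 1" using assms by (auto simp: primes_in_def)
    then have "real p / (real p - 1) = 1 + (1 / real p + 1 / (real p * (real p - 1)))"
      by (simp add: divide_simps)
    also have "\<dots> \<le> exp (1 / real p + 1 / (real p * (real p - 1)))" by (rule exp_ge_add_one_self)
    finally show "0 \<le> real p / (real p - 1) \<and> real p / (real p - 1) \<le>
        exp (1 / real p + 1 / (real p * (real p - 1)))" using p by simp
  qed
  also have "\<dots> = exp ((\<Sum>p\<in>primes_in z x. 1 / real p) + (\<Sum>p\<in>primes_in z x. 1 / (real p * (real p - 1))))"
    by (simp add: exp_sum [symmetric] sum.distrib)
  also have "\<dots> \<le> exp ((ln (ln x) - ln (ln z) + 13 / ln z) + 2 / z)"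
    using assms by (intro exp_le_cancel_iff [THEN iffD2] add_mono sum_inverse_primes_le
        sum_primes_consecutive_le)
  also have "\<dots> = ln x / ln z * exp (13 / ln z + 2 / z)"
    using lz by (simp add: exp_add exp_diff)
  finally show ?thesis .
qed

lemma card_multiples_le:
  assumes "p > 0"
  shows "real (card {t\<in>{1..h}. p dvd t}) \<le> real h / real p"
proof -
  have "{t\<in>{1..h}. p dvd t} \<subseteq> (*) p ` {1..h div p}"
  proof
    fix t assume t: "t \<in> {t\<in>{1..h}. p dvd t}"
    then obtain k where k: "t = p * k" by blast
    then have "k \<in> {1..h div p}"
      using t assms by (cases k) (auto simp: less_eq_div_iff_mult_less_eq mult.commute)
    then show "t \<in> (*) p ` {1..h div p}" using k by blast
  qed
  then have "card {t\<in>{1..h}. p dvd t} \<le> card ((*) p ` {1..h div p})"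
    by (intro card_mono) auto
  also have "\<dots> \<le> card {1..h div p}" by (rule card_image_le) simp
  also have "\<dots> = h div p" by simp
  finally have "real (card {t\<in>{1..h}. p dvd t}) \<le> real (h div p)" by simp
  then show ?thesis using of_nat_div_le_of_nat[of h p, where 'a = real] by linarith
qed

text \<open>Three cases cover every t: a prime factor above x, or z-smoothness, contributes at most
  1, while a prime factor p in (z, x] divides the gcd and contributes at most 1/p. Summed over the
  multiples of p, the case of (z, x] costs h/p^2 per prime, hence only 2 h / z in total.\<close>

lemma sum_inverse_gcd_le:
  fixes z x :: real and h :: nat
  assumes z: "2 \<le> z" "z \<le> x" and x: "x \<le> real h"
  defines "Q \<equiv> \<Prod>(primes_in z x)"
  shows "(\<Sum>t=1..h. 1 / real (gcd t Q)) \<le>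
    real h * (ln (ln (real h)) - ln (ln x) + 13 / ln x) + 2 * real h / z +
    real (card (smooth_upto (primes_in 0 z) h))"
proof -
  have Q: "p dvd Q" if "p \<in> primes_in z x" for p
    unfolding Q_def using dvd_prodI[OF finite_primes_in, of p z x "\<lambda>p. p"] that by simp
  have "1 / real (gcd t Q) \<le> (\<Sum>p\<in>primes_in x h. if p dvd t then 1 else 0) +
      (\<Sum>p\<in>primes_in z x. if p dvd t then 1 / real p else 0) +
      (if t \<in> smooth_upto (primes_in 0 z) h then 1 else 0)" (is "_ \<le> ?s1 + ?s2 + ?s3")
    if t: "t \<in> {1..h}" for t
  proof -
    have nn: "?s1 \<ge> 0" "?s2 \<ge> 0" "?s3 \<ge> 0" by (auto intro!: sum_nonneg)
    have g: "gcd t Q \<ge> 1" using t by (simp add: Suc_le_eq)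
    then have g1: "1 / real (gcd t Q) \<le> 1" by (subst divide_le_eq_1) linarith
    consider p where "p \<in> primes_in x h" "p dvd t" | p where "p \<in> primes_in z x" "p dvd t"
      | "t \<in> smooth_upto (primes_in 0 z) h"
    proof (cases "\<exists>p\<in>prime_factors t. real p > z")
      case True
      then obtain p where p: "prime p" "p dvd t" "real p > z" by (auto simp: prime_factors_dvd)
      have "p \<le> t" using p t by (intro dvd_imp_le) auto
      then have "real p \<le> real h" using t by simp
      with p that(1)[of p] that(2)[of p] show ?thesis by (force simp: primes_in_def not_le)
    next
      case False
      then have "prime_factors t \<subseteq> primes_in 0 z"
        by (force simp: primes_in_nonneg_eq prime_factors_dvd)
      then show ?thesis using that(3) t by (auto simp: smooth_upto_def)
    qed
    then show ?thesis
    proof cases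
      case 1
      then have "1 \<le> ?s1"
        using member_le_sum[of p "primes_in x h" "\<lambda>p. if p dvd t then 1 else 0 :: real"] by simp
      with nn g1 show ?thesis by linarith
    next
      case 2
      then have "p dvd gcd t Q" using Q by simp
      then have "p \<le> gcd t Q" using g by (intro dvd_imp_le) auto
      moreover have "p > 0" using 2 by (auto simp: primes_in_def prime_gt_0_nat)
      ultimately have "1 / real (gcd t Q) \<le> 1 / real p" by (intro frac_le) auto
      also have "\<dots> \<le> ?s2"
        using 2 member_le_sum[of p "primes_in z x" "\<lambda>p. if p dvd t then 1 / real p else 0"] by simp
      finally show ?thesis using nn by linarith
    next
      case 3
      with nn g1 show ?thesis by simp
    qed
  qed
  then have "(\<Sum>t=1..h. 1 / real (gcd t Q)) \<le> (\<Sum>t=1..h.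
      (\<Sum>p\<in>primes_in x h. if p dvd t then 1 else 0) +
      (\<Sum>p\<in>primes_in z x. if p dvd t then 1 / real p else 0) +
      (if t \<in> smooth_upto (primes_in 0 z) h then 1 else 0))"
    by (rule sum_mono)
  also have "\<dots> = (\<Sum>p\<in>primes_in x h. \<Sum>t=1..h. if p dvd t then 1 else 0) +
      (\<Sum>p\<in>primes_in z x. \<Sum>t=1..h. if p dvd t then 1 / real p else 0) +
      (\<Sum>t=1..h. if t \<in> smooth_upto (primes_in 0 z) h then 1 else 0)"
    unfolding sum.distrib by (intro arg_cong2[where f = "(+)"] sum.swap refl)
  also have "(\<Sum>p\<in>primes_in x h. \<Sum>t=1..h. if p dvd t then 1 else 0) \<le>
      real h * (ln (ln (real h)) - ln (ln x) + 13 / ln x)"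
  proof -
    have "(\<Sum>p\<in>primes_in x h. \<Sum>t=1..h. if p dvd t then 1 else 0 :: real) \<le>
        (\<Sum>p\<in>primes_in x h. real h * (1 / real p))"
    proof (rule sum_mono)
      fix p assume "p \<in> primes_in x h"
      then have "p > 0" by (simp add: primes_in_def prime_gt_0_nat)
      from card_multiples_le[OF this, of h]
      show "(\<Sum>t=1..h. if p dvd t then 1 else 0 :: real) \<le> real h * (1 / real p)"
        by (simp add: sum.inter_filter [symmetric])
    qed
    also have "\<dots> = real h * (\<Sum>p\<in>primes_in x h. 1 / real p)" by (simp add: sum_distrib_left)
    also have "\<dots> \<le> real h * (ln (ln (real h)) - ln (ln x) + 13 / ln x)"
      using z x by (intro mult_left_mono sum_inverse_primes_le) auto
    finally show ?thesis .
  qed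
  also have "(\<Sum>p\<in>primes_in z x. \<Sum>t=1..h. if p dvd t then 1 / real p else 0) \<le> 2 * real h / z"
  proof -
    have "(\<Sum>p\<in>primes_in z x. \<Sum>t=1..h. if p dvd t then 1 / real p else 0) \<le>
        (\<Sum>p\<in>primes_in z x. real h * (1 / (real p * (real p - 1))))"
    proof (rule sum_mono)
      fix p assume "p \<in> primes_in z x"
      then have p: "p > 0" "real p > 1" using z by (auto simp: primes_in_def prime_gt_0_nat)
      have "(\<Sum>t=1..h. if p dvd t then 1 / real p else 0) = real (card {t\<in>{1..h}. p dvd t}) / real p"
        by (simp add: sum.inter_filter [symmetric])
      also have "\<dots> \<le> real h / real p / real p"
        using card_multiples_le[OF p(1), of h] by (intro divide_right_mono) auto
      also have "\<dots> \<le> real h * (1 / (real p * (real p - 1)))"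
        using p by (simp add: divide_simps) (simp add: mult_left_mono)
      finally show "(\<Sum>t=1..h. if p dvd t then 1 / real p else 0) \<le>
          real h * (1 / (real p * (real p - 1)))" .
    qed
    also have "\<dots> = real h * (\<Sum>p\<in>primes_in z x. 1 / (real p * (real p - 1)))"
      by (simp add: sum_distrib_left)
    also have "\<dots> \<le> real h * (2 / z)" using z by (intro mult_left_mono sum_primes_consecutive_le) auto
    finally show ?thesis by (simp add: mult.commute)
  qed
  also have "(\<Sum>t=1..h. if t \<in> smooth_upto (primes_in 0 z) h then 1 else 0) =
      real (card (smooth_upto (primes_in 0 z) h))"
  proof -
    have "{t\<in>{1..h}. t \<in> smooth_upto (primes_in 0 z) h} = smooth_upto (primes_in 0 z) h"
      by (auto simp: smooth_upto_def)
    then show ?thesis by (simp add: sum.inter_filter [symmetric])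
  qed
  finally show ?thesis by simp
qed

section \<open>Sums of prime factors along arithmetic progressions\<close>

lemma S_one [simp]: "S (Suc 0) = 0" by (simp add: S_def)

lemma S_mult:
  assumes "a > 0" "b > 0"
  shows "S (a * b) = S a + S b"
proof -
  have *: "S n = (\<Sum>p\<in>prime_factors (a * b). multiplicity p n * p)"
    if "n > 0" "prime_factors n \<subseteq> prime_factors (a * b)" for n
    unfolding S_def using that
    by (intro sum.mono_neutral_left ballI)
      (auto simp: in_prime_factors_iff not_dvd_imp_multiplicity_0)
  have "S a = (\<Sum>p\<in>prime_factors (a * b). multiplicity p a * p)"
    "S b = (\<Sum>p\<in>prime_factors (a * b). multiplicity p b * p)"
    using assms by (intro *; simp add: prime_factors_product)+
  moreover have "S (a * b) = (\<Sum>p\<in>prime_factors (a * b). (multiplicity p a + multiplicity p b) * p)"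
    unfolding S_def using assms
    by (intro sum.cong refl) (auto simp: prime_elem_multiplicity_mult_distrib in_prime_factors_iff)
  ultimately show ?thesis by (simp add: sum.distrib add_mult_distrib)
qed

lemma S_prime: "prime p \<Longrightarrow> S p = p"
  by (simp add: S_def prime_prime_factors)

lemma S_le: "n > 0 \<Longrightarrow> S n \<le> n"
proof (induction n rule: prime_divisors_induct)
  case (factor p n)
  have p: "p \<ge> 2" using factor by (simp add: prime_ge_2_nat)
  have n: "n > 0" using factor by (cases n) auto
  have "S (p * n) = p + S n" using factor n p by (simp add: S_mult S_prime)
  also have "\<dots> \<le> p * n"
  proof (cases "n = 1")
    case False
    then have "p * 2 \<le> p * n" "2 * n \<le> p * n" using n p by (auto intro!: mult_le_mono)
    then show ?thesis using factor.IH[OF n] by linarith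
  qed simp
  finally show ?case .
qed auto

text \<open>There are at most \<open>log 2 n\<close> prime factors counted with multiplicity, each
  at most \<open>b\<close>.\<close>

lemma S_smooth_le:
  fixes b :: real
  assumes "n > 0" "\<And>p. prime p \<Longrightarrow> p dvd n \<Longrightarrow> real p \<le> b" "b \<ge> 0"
  shows "real (S n) \<le> b * log 2 (real n)"
  using assms(1,2)
proof (induction n rule: prime_divisors_induct)
  case (factor p n)
  have p: "p \<ge> 2" using factor by (simp add: prime_ge_2_nat)
  have n: "n > 0" using factor by (cases n) auto
  have "real (S (p * n)) = real p + real (S n)" using factor n p by (simp add: S_mult S_prime)
  also have "\<dots> \<le> b + b * log 2 (real n)"
    using factor n by (intro add_mono factor.IH) auto
  also have "\<dots> = b * (1 + log 2 (real n))" by (simp add: algebra_simps)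
  also have "1 + log 2 (real n) \<le> log 2 (real p) + log 2 (real n)"
    using p by (simp add: le_log_iff)
  also have "\<dots> = log 2 (real (p * n))" using n p by (simp add: log_mult)
  finally show ?case using assms(3) by (simp add: mult_left_mono)
qed auto

text \<open>If v = m q with q prime and m <= M, then S v = q + S m, where q = v/m is one of the
  summands and S m <= M. Otherwise every prime factor of v is at most v/M and
  \<open>S_smooth_le\<close> applies.\<close>

lemma S_le_prime_cofactors:
  fixes v M :: nat
  assumes "v > 0" "M > 0"
  shows "real (S v) \<le> real M + real v / real M * log 2 (real v) +
    (\<Sum>m\<in>{1..M}. if m dvd v \<and> prime (v div m) then real v / real m else 0)"
    (is "_ \<le> _ + _ + ?s")
proof (cases "\<exists>q. prime q \<and> q dvd v \<and> v \<le> q * M")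
  case True
  then obtain q where q: "prime q" "q dvd v" "v \<le> q * M" by blast
  then obtain m where m: "v = m * q" by (metis dvdE mult.commute)
  have m0: "m > 0" using m assms by (cases m) auto
  have "m \<le> M" using q m prime_gt_0_nat[OF q(1)] by (simp add: mult.commute)
  have "real (S v) = real q + real (S m)"
    using m m0 q by (simp add: S_mult S_prime prime_gt_0_nat)
  also have "real (S m) \<le> real M" using S_le[OF m0] \<open>m \<le> M\<close> by simp
  also have "real q = (if m dvd v \<and> prime (v div m) then real v / real m else 0)"
    using m m0 q by simp
  also have "\<dots> \<le> ?s"
    using m0 \<open>m \<le> M\<close>
    by (intro member_le_sum[of m "{1..M}" "\<lambda>m. if m dvd v \<and> prime (v div m) then real v / real m else 0"]) auto
  finally have "real (S v) \<le> ?s + real M" by simp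
  moreover have "0 \<le> real v / real M * log 2 (real v)" using assms by simp
  ultimately show ?thesis by linarith
next
  case False
  have "real p \<le> real v / real M" if "prime p" "p dvd v" for p
  proof -
    have "\<not> v \<le> p * M" using False that by blast
    then have "p * M \<le> v" by simp
    then have "real p * real M \<le> real v" by (metis of_nat_le_iff of_nat_mult)
    then show ?thesis using assms by (simp add: field_simps)
  qed
  then have "real (S v) \<le> real v / real M * log 2 (real v)"
    using assms by (intro S_smooth_le) auto
  moreover have "?s \<ge> 0" by (intro sum_nonneg) auto
  ultimately show ?thesis by simp
qed

text \<open>As t is coprime to Q, m divides a value only if m is coprime to Q. The solutions are
  then k0 + m j with k0 the least one, and the quotients are j Q + r: again a progression modulo Q,
  with at most H/m + 1 terms, so the cost Q/phi(Q) does not depend on m.\<close>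

lemma card_prime_cofactors_le:
  fixes Q t m Z :: nat
  assumes "coprime t Q" and m: "m \<ge> 1" and Q: "Q > 0" and Z: "Z \<ge> 2"
    and B: "finite B" "\<And>p. p \<in> B \<Longrightarrow> prime p" "\<And>p. prime p \<Longrightarrow> p dvd Q \<Longrightarrow> p \<in> B"
  shows "real (card {k\<in>{a..<a + H}. m dvd k * Q + t \<and> prime ((k * Q + t) div m)}) \<le>
    (real H / real m + 1) * totient_ratio B / ln (real Z) + 2 * (real Z)\<^sup>2"
proof (cases "{k\<in>{a..<a + H}. m dvd k * Q + t} = {}")
  case True
  then have "{k\<in>{a..<a + H}. m dvd k * Q + t \<and> prime ((k * Q + t) div m)} = {}" by blast
  moreover have "0 < totient_ratio B" using B(2) by (rule totient_ratio_pos)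
  ultimately show ?thesis using Z by (simp only: card.empty) simp
next
  case False
  define E where "E = {k\<in>{a..<a + H}. m dvd k * Q + t}"
  define k0 where "k0 = Min E"
  define r where "r = (k0 * Q + t) div m"
  define X where "X = H div m + 1"
  have "finite E" "E \<noteq> {}" using False by (auto simp: E_def)
  then have k0: "k0 \<in> E" "\<And>k. k \<in> E \<Longrightarrow> k0 \<le> k" by (auto simp: k0_def)
  have "coprime m Q"
  proof (rule coprimeI)
    fix c assume c: "c dvd m" "c dvd Q"
    have "c dvd k0 * Q + t" using k0(1) c(1) by (auto simp: E_def intro: dvd_trans)
    then have "c dvd t" using c(2) by (simp add: dvd_add_right_iff)
    then show "is_unit c" using assms(1) c(2) by (metis coprime_common_divisor)
  qed
  have r: "k0 * Q + t = m * r" using k0(1) by (simp add: E_def r_def)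
  have "{k\<in>{a..<a + H}. m dvd k * Q + t \<and> prime ((k * Q + t) div m)} \<subseteq>
      (\<lambda>j. k0 + m * j) ` {j\<in>{0..<0 + X}. prime (j * Q + r)}"
  proof
    fix k assume k: "k \<in> {k\<in>{a..<a + H}. m dvd k * Q + t \<and> prime ((k * Q + t) div m)}"
    then have kE: "k \<in> E" by (simp add: E_def)
    have eq: "k * Q + t = (k - k0) * Q + (k0 * Q + t)"
      using k0(2)[OF kE] by (simp add: diff_mult_distrib)
    then have "m dvd (k - k0) * Q"
      using k k0(1) by (metis (no_types, lifting) E_def dvd_add_left_iff mem_Collect_eq)
    then have "m dvd k - k0" using \<open>coprime m Q\<close> by (simp add: coprime_dvd_mult_left_iff)
    then obtain j where j: "k - k0 = m * j" by blast
    have kj: "k = k0 + m * j" using j k0(2)[OF kE] by simp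
    have "k * Q + t = m * (j * Q + r)" using eq r j by (simp add: algebra_simps)
    then have "prime (j * Q + r)" using k m by simp
    moreover have "j < X"
    proof -
      have "k - k0 < H" using k k0(1) by (auto simp: E_def)
      then have "j \<le> H div m" using j m by (simp add: less_eq_div_iff_mult_less_eq mult.commute)
      then show ?thesis by (simp add: X_def)
    qed
    ultimately show "k \<in> (\<lambda>j. k0 + m * j) ` {j\<in>{0..<0 + X}. prime (j * Q + r)}"
      using kj by auto
  qed
  then have "card {k\<in>{a..<a + H}. m dvd k * Q + t \<and> prime ((k * Q + t) div m)} \<le>
      card ((\<lambda>j. k0 + m * j) ` {j\<in>{0..<0 + X}. prime (j * Q + r)})"
    by (intro card_mono) auto
  also have "\<dots> \<le> card {j\<in>{0..<0 + X}. prime (j * Q + r)}" by (rule card_image_le) simp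
  finally have "real (card {k\<in>{a..<a + H}. m dvd k * Q + t \<and> prime ((k * Q + t) div m)}) \<le>
      real (card {j\<in>{0..<0 + X}. prime (j * Q + r)})" by simp
  also have "\<dots> \<le> real X * totient_ratio B / ln (real Z) + 2 * (real Z)\<^sup>2"
    using Z Q B by (rule brun_titchmarsh)
  also have "real X \<le> real H / real m + 1"
    using of_nat_div_le_of_nat[of H m, where 'a = real] by (simp add: X_def)
  finally show ?thesis
    using Z totient_ratio_pos[of B] B(2) by (simp add: divide_right_mono mult_right_mono)
qed

lemma sum_inverse_squares_le: "(\<Sum>m=1..M. 1 / (real m)\<^sup>2) \<le> pi\<^sup>2 / 6"
proof -
  have "(\<Sum>m=1..M. 1 / (real m)\<^sup>2) = (\<Sum>n<M. 1 / (real n + 1)\<^sup>2)"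
    by (intro sum.reindex_bij_witness[of _ Suc "\<lambda>m. m - 1"]) auto
  also have "\<dots> \<le> pi\<^sup>2 / 6"
    using inverse_squares_sums sum_le_suminf[of "\<lambda>n. 1 / (real n + 1)\<^sup>2" "{..<M}"]
    by (simp add: sums_iff add.commute)
  finally show ?thesis .
qed

text \<open>A prime quotient by m is at most V/m and occurs for a share of about R/m of the k,
  whence the sum of 1/m^2. In the error term the weight V/m is simply bounded by V.\<close>

lemma sum_S_linear_le:
  fixes Q t M Z a H :: nat and V :: real
  assumes "coprime t Q" and M: "M \<ge> 1" and Q: "Q > 0" and t: "t > 0" and H: "H > 0" and Z: "Z \<ge> 2"
    and B: "finite B" "\<And>p. p \<in> B \<Longrightarrow> prime p" "\<And>p. prime p \<Longrightarrow> p dvd Q \<Longrightarrow> p \<in> B"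
    and V: "\<And>k. k < a + H \<Longrightarrow> real (k * Q + t) \<le> V"
  defines "R \<equiv> totient_ratio B / ln (real Z)"
  shows "(\<Sum>k\<in>{a..<a + H}. real (S (k * Q + t))) \<le>
    real H * (real M + V / real M * log 2 V) +
    V * (pi\<^sup>2 / 6 * real H * R + real M * (R + 2 * (real Z)\<^sup>2))"
proof -
  have R: "R > 0" unfolding R_def using Z totient_ratio_pos[of B] B(2) by simp
  have V1: "V \<ge> 1" using V[of a] H t by linarith
  have "(\<Sum>k\<in>{a..<a + H}. real (S (k * Q + t))) \<le>
      (\<Sum>k\<in>{a..<a + H}. (real M + V / real M * log 2 V) +
        (\<Sum>m\<in>{1..M}. V / real m * (if m dvd k * Q + t \<and> prime ((k * Q + t) div m) then 1 else 0)))"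
  proof (rule sum_mono)
    fix k assume k: "k \<in> {a..<a + H}"
    define v where "v = k * Q + t"
    have v: "v > 0" "real v \<le> V" using t V[of k] k by (auto simp: v_def)
    have "real (S v) \<le> real M + real v / real M * log 2 (real v) +
        (\<Sum>m\<in>{1..M}. if m dvd v \<and> prime (v div m) then real v / real m else 0)"
      using v M by (intro S_le_prime_cofactors) auto
    also have "real v / real M * log 2 (real v) \<le> V / real M * log 2 V"
      using v M by (intro mult_mono divide_right_mono) auto
    also have "(\<Sum>m\<in>{1..M}. if m dvd v \<and> prime (v div m) then real v / real m else 0) \<le>
        (\<Sum>m\<in>{1..M}. V / real m * (if m dvd v \<and> prime (v div m) then 1 else 0))"
      using v by (intro sum_mono) (auto simp: divide_right_mono)
    finally show "real (S (k * Q + t)) \<le> (real M + V / real M * log 2 V) +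
        (\<Sum>m\<in>{1..M}. V / real m * (if m dvd k * Q + t \<and> prime ((k * Q + t) div m) then 1 else 0))"
      by (simp add: v_def)
  qed
  also have "\<dots> = real H * (real M + V / real M * log 2 V) +
      (\<Sum>m\<in>{1..M}. V / real m *
        real (card {k\<in>{a..<a + H}. m dvd k * Q + t \<and> prime ((k * Q + t) div m)}))"
  proof -
    have "(\<Sum>k\<in>{a..<a + H}. V / real m *
          (if m dvd k * Q + t \<and> prime ((k * Q + t) div m) then 1 else 0)) =
        V / real m * real (card {k\<in>{a..<a + H}. m dvd k * Q + t \<and> prime ((k * Q + t) div m)})" for m
      by (subst sum_distrib_left [symmetric], subst sum.inter_filter [symmetric]) simp_all
    then show ?thesis unfolding sum.distrib by (subst sum.swap) (simp add: distrib_left)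
  qed
  also have "(\<Sum>m\<in>{1..M}. V / real m *
        real (card {k\<in>{a..<a + H}. m dvd k * Q + t \<and> prime ((k * Q + t) div m)})) \<le>
      (\<Sum>m\<in>{1..M}. V * (real H * R * (1 / (real m)\<^sup>2)) + V * (R + 2 * (real Z)\<^sup>2))"
  proof (rule sum_mono)
    fix m assume m: "m \<in> {1..M}"
    have "real (card {k\<in>{a..<a + H}. m dvd k * Q + t \<and> prime ((k * Q + t) div m)}) \<le>
        (real H / real m + 1) * totient_ratio B / ln (real Z) + 2 * (real Z)\<^sup>2"
      using m assms(1) Q Z B by (intro card_prime_cofactors_le) auto
    also have "\<dots> = real H * R / real m + (R + 2 * (real Z)\<^sup>2)"
      by (simp add: R_def add_divide_distrib algebra_simps)
    finally have "V / real m * real (card {k\<in>{a..<a + H}. m dvd k * Q + t \<and> prime ((k * Q + t) div m)}) \<le>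
        V / real m * (real H * R / real m + (R + 2 * (real Z)\<^sup>2))"
      using V1 by (intro mult_left_mono) auto
    also have "\<dots> = V * (real H * R * (1 / (real m)\<^sup>2)) + V / real m * (R + 2 * (real Z)\<^sup>2)"
      by (simp add: distrib_left power2_eq_square)
    also have "V / real m * (R + 2 * (real Z)\<^sup>2) \<le> V / 1 * (R + 2 * (real Z)\<^sup>2)"
      using m V1 R by (intro mult_right_mono divide_left_mono) auto
    finally show "V / real m * real (card {k\<in>{a..<a + H}. m dvd k * Q + t \<and> prime ((k * Q + t) div m)}) \<le>
        V * (real H * R * (1 / (real m)\<^sup>2)) + V * (R + 2 * (real Z)\<^sup>2)" by simp
  qed
  also have "\<dots> = V * (real H * R * (\<Sum>m=1..M. 1 / (real m)\<^sup>2)) + real M * (V * (R + 2 * (real Z)\<^sup>2))"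
    by (simp add: sum.distrib sum_distrib_left)
  also have "\<dots> \<le> V * (real H * R * (pi\<^sup>2 / 6)) + real M * (V * (R + 2 * (real Z)\<^sup>2))"
    using V1 R by (intro add_right_mono mult_left_mono sum_inverse_squares_le) auto
  finally show ?thesis by (simp add: algebra_simps)
qed

section \<open>Averaging over multiples of Q\<close>

lemma f_gt:
  assumes "n > 0" "(\<Sum>t=1..h. S (n + t)) \<le> n"
  shows "f n > h"
proof (rule ccontr)
  assume "\<not> f n > h"
  then have "(\<Sum>t=1..f n. S (n + t)) \<le> (\<Sum>t=1..h. S (n + t))"
    by (intro sum_mono2) auto
  then show False using f_well_defined[OF assms(1)] assms(2) by linarith
qed

text \<open>If no k worked, every inner sum would exceed k Q >= A Q, and so would their average. In
  \<open>small\<close>, h * h comes from S d <= h for the common factors d, h * M from the small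
  cofactors, and 1/gcd from the size V/d of the values after division by d.\<close>

theorem ex_multiple_f_gt:
  fixes B :: "nat set" and h A H M Z :: nat and V :: real
  defines "Q \<equiv> \<Prod>B" and "R \<equiv> totient_ratio B / ln (real Z)"
  assumes B: "finite B" "\<And>p. p \<in> B \<Longrightarrow> prime p"
    and pos: "h \<ge> 1" "A \<ge> 1" "H \<ge> 1" "M \<ge> 1" "Z \<ge> 2"
    and V: "real ((A + H) * Q + h) \<le> V"
    and small: "real h * real h + real h * real M + (\<Sum>t=1..h. 1 / real (gcd t Q)) * V *
      (log 2 V / real M + pi\<^sup>2 / 6 * R + real M * (R + 2 * (real Z)\<^sup>2) / real H) < real A * real Q"
  shows "\<exists>k\<in>{A..<A + H}. f (k * Q) > h"
proof (rule ccontr)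
  assume neg: "\<not> ?thesis"
  have Q: "Q > 0" unfolding Q_def using B(2) by (intro prod_pos) (auto simp: prime_gt_0_nat)
  have "1 \<le> (A + H) * Q + h" using pos by simp
  then have "1 \<le> real ((A + H) * Q + h)" by linarith
  with V have V1: "V \<ge> 1" by linarith
  have R0: "R \<ge> 0" unfolding R_def using pos totient_ratio_pos[of B] B(2) by simp
  define W where "W = V * (log 2 V / real M) + V * (pi\<^sup>2 / 6 * R) + V * (real M * (R + 2 * (real Z)\<^sup>2) / real H)"
  have "real H * (real A * real Q) = (\<Sum>k\<in>{A..<A + H}. real (A * Q))" by simp
  also have "\<dots> \<le> (\<Sum>k\<in>{A..<A + H}. \<Sum>t=1..h. real (S (k * Q + t)))"
  proof (rule sum_mono)
    fix k assume k: "k \<in> {A..<A + H}"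
    then have "k * Q > 0" using pos Q by auto
    then have "\<not> (\<Sum>t=1..h. S (k * Q + t)) \<le> k * Q" using neg k f_gt by blast
    then have "k * Q \<le> (\<Sum>t=1..h. S (k * Q + t))" by simp
    moreover have "A * Q \<le> k * Q" using k by (intro mult_le_mono1) simp
    ultimately have "A * Q \<le> (\<Sum>t=1..h. S (k * Q + t))" by linarith
    then have "real (A * Q) \<le> real (\<Sum>t=1..h. S (k * Q + t))" by (rule of_nat_mono)
    then show "real (A * Q) \<le> (\<Sum>t=1..h. real (S (k * Q + t)))" by simp
  qed
  also have "\<dots> = (\<Sum>t=1..h. \<Sum>k\<in>{A..<A + H}. real (S (k * Q + t)))" by (rule sum.swap)
  also have "\<dots> \<le> (\<Sum>t=1..h. real H * (real h + real M) + 1 / real (gcd t Q) * (real H * W))"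
  proof (rule sum_mono)
    fix t assume t: "t \<in> {1..h}"
    \<comment> \<open>Division by d makes offset and modulus coprime, as the sieve bound requires.
      The primes of the new modulus still lie in \<open>B\<close>, so the same R applies to every
      t.\<close>
    define d where "d = gcd t Q"
    define q where "q = Q div d"
    define s where "s = t div d"
    have d: "d > 0" "d \<le> h" using t Q by (auto simp: d_def intro: order_trans[OF gcd_le1_nat])
    have dq: "Q = d * q" "t = d * s" by (simp_all add: q_def s_def d_def)
    have q0: "q > 0" and s0: "s > 0" using dq Q t by (auto intro: Nat.gr0I)
    have cop: "coprime s q" unfolding s_def q_def d_def using Q by (intro div_gcd_coprime) auto
    have inB: "p \<in> B" if "prime p" "p dvd q" for p
    proof -
      have "p dvd \<Prod>B" using that dq unfolding Q_def by simp
      then show ?thesis using that B prime_prod_iff_mem by blast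
    qed
    have Vd: "real (k * q + s) \<le> V / real d" if "k < A + H" for k
    proof -
      have "k * Q + t \<le> (A + H) * Q + h" using that t by (intro add_mono mult_le_mono1) auto
      then have "real (k * Q + t) \<le> V" using V by (meson of_nat_mono order_trans)
      moreover have "k * Q + t = d * (k * q + s)" using dq by (simp add: algebra_simps)
      ultimately have "real d * real (k * q + s) \<le> V" by (metis of_nat_mult)
      then show ?thesis using d by (simp add: field_simps)
    qed
    have "(\<Sum>k\<in>{A..<A + H}. real (S (k * Q + t))) =
        (\<Sum>k\<in>{A..<A + H}. real (S d) + real (S (k * q + s)))"
    proof (intro sum.cong refl)
      fix k
      have "k * Q + t = d * (k * q + s)" using dq by (simp add: algebra_simps)
      then show "real (S (k * Q + t)) = real (S d) + real (S (k * q + s))"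
        using d s0 by (simp add: S_mult)
    qed
    also have "\<dots> = real H * real (S d) + (\<Sum>k\<in>{A..<A + H}. real (S (k * q + s)))"
      by (simp add: sum.distrib)
    also have "real (S d) \<le> real h" using S_le[OF d(1)] d(2) by simp
    also have "(\<Sum>k\<in>{A..<A + H}. real (S (k * q + s))) \<le>
        real H * (real M + V / real d / real M * log 2 (V / real d)) +
        V / real d * (pi\<^sup>2 / 6 * real H * R + real M * (R + 2 * (real Z)\<^sup>2))"
      unfolding R_def using cop pos q0 s0 B inB Vd by (intro sum_S_linear_le) auto
    also have "V / real d / real M * log 2 (V / real d) \<le> V / real d / real M * log 2 V"
    proof (intro mult_left_mono)
      have "1 \<le> A * q + s" using s0 by simp
      then have "1 \<le> real (A * q + s)" by linarith
      also have "\<dots> \<le> V / real d" using pos by (intro Vd) auto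
      finally have "V / real d \<ge> 1" .
      moreover have "V / real d \<le> V" using d V1 by (simp add: divide_le_eq mult_le_cancel_left1)
      ultimately show "log 2 (V / real d) \<le> log 2 V" by simp
    qed (use V1 in auto)
    finally have "(\<Sum>k\<in>{A..<A + H}. real (S (k * Q + t))) \<le> real H * real h +
        (real H * (real M + V / real d / real M * log 2 V) +
        V / real d * (pi\<^sup>2 / 6 * real H * R + real M * (R + 2 * (real Z)\<^sup>2)))"
      by (simp add: mult_left_mono)
    also have "\<dots> = real H * (real h + real M) + 1 / real d * (real H * W)"
    proof -
      have "real H * (V * (real M * (R + 2 * (real Z)\<^sup>2) / real H)) = V * (real M * (R + 2 * (real Z)\<^sup>2))"
        using pos by simp
      then have "real H * W = real H * (V / real M * log 2 V) + V * (pi\<^sup>2 / 6 * real H * R) +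
          V * (real M * (R + 2 * (real Z)\<^sup>2))"
        unfolding W_def distrib_left by simp
      then show ?thesis by (simp add: add_divide_distrib distrib_left)
    qed
    finally show "(\<Sum>k\<in>{A..<A + H}. real (S (k * Q + t))) \<le>
        real H * (real h + real M) + 1 / real (gcd t Q) * (real H * W)" by (simp add: d_def)
  qed
  also have "\<dots> = real H * (real h * real h + real h * real M + (\<Sum>t=1..h. 1 / real (gcd t Q)) * W)"
    unfolding sum.distrib sum_distrib_right [symmetric] by (simp add: algebra_simps)
  finally have "real A * real Q \<le> real h * real h + real h * real M + (\<Sum>t=1..h. 1 / real (gcd t Q)) * W"
    using pos by simp
  then show False using small by (simp add: W_def distrib_left mult.assoc)
qed

section \<open>Choice of parameters\<close>

text \<open>On the scale w = x log_3 x the bound for the sum of 1/gcd is asymptotic to c w, and R is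
  asymptotic to 2 b / w. The left side therefore tends to c * 2 b * pi^2/6 = c b pi^2/3 < 1; all
  other terms are o(1).\<close>

lemma main_inequality_eventually:
  fixes b c C :: real
  assumes bc: "c > 0" "b > 2" "c * b * pi\<^sup>2 < 3"
  defines "z \<equiv> \<lambda>x. exp (ln x * ln (ln (ln x)) / (b * ln (ln x)))"
    and "u \<equiv> \<lambda>x. c * x * ln x * ln (ln (ln x)) / ln (ln x)"
    and "y \<equiv> \<lambda>x. ln (ln x) / ln (ln (ln x))"
    and "E \<equiv> \<lambda>x. exp (x * ln (ln x))"
    and "R \<equiv> \<lambda>x. ln x / ln (exp (ln x * ln (ln (ln x)) / (b * ln (ln x)))) *
      exp (13 / ln (exp (ln x * ln (ln (ln x)) / (b * ln (ln x)))) +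
        2 / exp (ln x * ln (ln (ln x)) / (b * ln (ln x)))) / (x * ln (ln x) / 2 - 5 * ln x)"
  shows "eventually (\<lambda>x. (u x * u x + u x * (x ^ 4 + 1)) / E x +
      u x * (ln (ln (u x)) - ln (ln x) + 13 / ln x + 2 / z x +
        C * exp (- (ln (y x) / ln (z x) * ln x)) * ln (z x) * exp (3 * y x)) *
      (1 + 1 / x + (1 + u x) / E x) *
      (((x * ln (ln x) + x * ln 4 + ln 4) / ln 2) / x ^ 4 + pi\<^sup>2 / 6 * R x +
       (x ^ 4 + 1) * (R x + 2 * (E x / x ^ 8)) / (E x / x)) < 1) at_top"
proof -
  define w where "w x = x * ln (ln (ln x))" for x :: real
  define T where "T x = u x * (ln (ln (u x)) - ln (ln x) + 13 / ln x + 2 / z x +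
        C * exp (- (ln (y x) / ln (z x) * ln x)) * ln (z x) * exp (3 * y x))" for x
  have 1: "((\<lambda>x. (u x * u x + u x * (x ^ 4 + 1)) / E x) \<longlongrightarrow> 0) at_top"
    unfolding u_def E_def using bc by real_asymp
  \<comment> \<open>Here u/w = c ln x / ln (ln x), and ln (ln u) - ln (ln x) is asymptotic to ln (ln
    x) / ln x because u/x is ln x up to factors of lower order.\<close>
  have T1: "((\<lambda>x. u x * (ln (ln (u x)) - ln (ln x) + 13 / ln x) / w x) \<longlongrightarrow> c) at_top"
    unfolding u_def w_def using bc by real_asymp
  have T2: "((\<lambda>x. u x * (2 / z x) / w x) \<longlongrightarrow> 0) at_top"
    unfolding u_def z_def w_def using bc by real_asymp
  \<comment> \<open>This is where b > 2 enters: the quotient is (ln x)^(2 - b + o(1)). The choice of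
    y makes ln y asymptotic to ln (ln (ln x)) while exp(3 y) stays (ln x)^o(1).\<close>
  have T3: "((\<lambda>x. u x * (exp (- (ln (y x) / ln (z x) * ln x)) * ln (z x) * exp (3 * y x)) / w x) \<longlongrightarrow> 0) at_top"
    unfolding u_def z_def w_def y_def using bc by real_asymp
  have "((\<lambda>x. u x * (ln (ln (u x)) - ln (ln x) + 13 / ln x) / w x + u x * (2 / z x) / w x +
      C * (u x * (exp (- (ln (y x) / ln (z x) * ln x)) * ln (z x) * exp (3 * y x)) / w x)) \<longlongrightarrow>
      c + 0 + C * 0) at_top"
    by (intro tendsto_intros T1 T2 T3)
  also have "(\<lambda>x. u x * (ln (ln (u x)) - ln (ln x) + 13 / ln x) / w x + u x * (2 / z x) / w x +
      C * (u x * (exp (- (ln (y x) / ln (z x) * ln x)) * ln (z x) * exp (3 * y x)) / w x)) = (\<lambda>x. T x / w x)"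
    by (simp add: T_def fun_eq_iff add_divide_distrib diff_divide_distrib algebra_simps)
  finally have T: "((\<lambda>x. T x / w x) \<longlongrightarrow> c) at_top" by simp
  have 2: "((\<lambda>x. 1 + 1 / x + (1 + u x) / E x) \<longlongrightarrow> 1) at_top"
    unfolding u_def E_def using bc by real_asymp
  have 3: "((\<lambda>x. w x * (((x * ln (ln x) + x * ln 4 + ln 4) / ln 2) / x ^ 4)) \<longlongrightarrow> 0) at_top"
    unfolding w_def by real_asymp
  \<comment> \<open>R behaves like b ln (ln x) / ln (ln (ln x)) times 2 / (x ln (ln x)); the 2
    reflects that ln Z is half of ln A.\<close>
  have 4: "((\<lambda>x. w x * R x) \<longlongrightarrow> 2 * b) at_top"
    unfolding w_def R_def using bc by real_asymp
  have 5: "((\<lambda>x. w x * ((x ^ 4 + 1) * (2 * (E x / x ^ 8)) / (E x / x))) \<longlongrightarrow> 0) at_top"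
    unfolding w_def E_def by real_asymp
  have 6: "((\<lambda>x. (x ^ 4 + 1) / (E x / x)) \<longlongrightarrow> 0) at_top"
    unfolding E_def by real_asymp
  have "((\<lambda>x. (u x * u x + u x * (x ^ 4 + 1)) / E x + (T x / w x) * (1 + 1 / x + (1 + u x) / E x) *
      (w x * (((x * ln (ln x) + x * ln 4 + ln 4) / ln 2) / x ^ 4) + pi\<^sup>2 / 6 * (w x * R x) +
       ((w x * R x) * ((x ^ 4 + 1) / (E x / x)) + w x * ((x ^ 4 + 1) * (2 * (E x / x ^ 8)) / (E x / x)))))
      \<longlongrightarrow> 0 + c * 1 * (0 + pi\<^sup>2 / 6 * (2 * b) + ((2 * b) * 0 + 0))) at_top"
    by (intro tendsto_intros 1 2 3 4 5 6 T)
  moreover have "0 + c * 1 * (0 + pi\<^sup>2 / 6 * (2 * b) + ((2 * b) * 0 + 0)) < 1"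
    using bc by (simp add: mult_ac)
  ultimately have "eventually (\<lambda>x. (u x * u x + u x * (x ^ 4 + 1)) / E x +
      (T x / w x) * (1 + 1 / x + (1 + u x) / E x) *
      (w x * (((x * ln (ln x) + x * ln 4 + ln 4) / ln 2) / x ^ 4) + pi\<^sup>2 / 6 * (w x * R x) +
       ((w x * R x) * ((x ^ 4 + 1) / (E x / x)) + w x * ((x ^ 4 + 1) * (2 * (E x / x ^ 8)) / (E x / x)))) < 1) at_top"
    by (rule order_tendstoD)
  moreover have "eventually (\<lambda>x. w x > 0) at_top"
    unfolding w_def by real_asymp
  ultimately show ?thesis
  proof eventually_elim
    case (elim x)
    have "(T x / w x) * (1 + 1 / x + (1 + u x) / E x) *
      (w x * (((x * ln (ln x) + x * ln 4 + ln 4) / ln 2) / x ^ 4) + pi\<^sup>2 / 6 * (w x * R x) +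
       ((w x * R x) * ((x ^ 4 + 1) / (E x / x)) + w x * ((x ^ 4 + 1) * (2 * (E x / x ^ 8)) / (E x / x)))) =
      (T x / w x) * (1 + 1 / x + (1 + u x) / E x) *
      (w x * (((x * ln (ln x) + x * ln 4 + ln 4) / ln 2) / x ^ 4 + pi\<^sup>2 / 6 * R x +
       (x ^ 4 + 1) * (R x + 2 * (E x / x ^ 8)) / (E x / x)))"
      by (simp only: distrib_left add_divide_distrib times_divide_eq_right mult_ac)
    also have "\<dots> = T x * (1 + 1 / x + (1 + u x) / E x) *
      (((x * ln (ln x) + x * ln 4 + ln 4) / ln 2) / x ^ 4 + pi\<^sup>2 / 6 * R x +
       (x ^ 4 + 1) * (R x + 2 * (E x / x ^ 8)) / (E x / x))"
      using elim(2) by simp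
    finally show ?case using elim(1) unfolding T_def by simp
  qed
qed

lemma prod_primes_in_le:
  assumes "x \<ge> 0" "z \<ge> 0"
  shows "real (\<Prod>(primes_in z x)) \<le> exp (x * ln 4)"
proof -
  have pos: "real p > 0" if "p \<in> primes_in z x" for p
    using that by (auto simp: primes_in_def prime_gt_0_nat)
  have "ln (\<Prod>p\<in>primes_in z x. real p) = (\<Sum>p\<in>primes_in z x. ln (real p))"
    using pos by (intro ln_prod) auto
  also have "\<dots> \<le> (\<Sum>p\<in>primes_in 0 x. ln (real p))"
  proof (rule sum_mono2)
    show "primes_in z x \<subseteq> primes_in 0 x" using assms by (auto simp: primes_in_def)
    show "0 \<le> ln (real p)" if "p \<in> primes_in 0 x - primes_in z x" for p
      using that prime_real_gt_1[of p] by (simp add: primes_in_def)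
  qed simp
  also have "\<dots> \<le> x * ln 4" using assms by (intro theta_le)
  finally have "exp (ln (\<Prod>p\<in>primes_in z x. real p)) \<le> exp (x * ln 4)" by simp
  moreover have "(\<Prod>p\<in>primes_in z x. real p) > 0" using pos by (rule prod_pos)
  ultimately show ?thesis by simp
qed

text \<open>Rounds the real parameters of \<open>main_inequality_eventually\<close> to integers and
  feeds them to \<open>ex_multiple_f_gt\<close>. Both bounds on ln n matter later: the lower one
  makes n unbounded, the upper one lets x be estimated from below through n.\<close>

theorem eventually_ex_large_f:
  fixes b c :: real
  assumes bc: "c > 0" "b > 2" "c * b * pi\<^sup>2 < 3"
  shows "eventually (\<lambda>x. \<exists>n. n > 0 \<and> x * ln (ln x) \<le> ln (real n) \<and> ln (real n) \<le> x * ln (ln x) + 3 * x \<and>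
    c * x * ln x * ln (ln (ln x)) / ln (ln x) \<le> real (f n)) at_top"
proof -
  obtain C where C: "C > 0" "\<And>z y h. z \<ge> 2 \<Longrightarrow> y \<ge> 1 \<Longrightarrow> 4 * ln y \<le> ln z \<Longrightarrow> h \<ge> 1 \<Longrightarrow>
     real (card (smooth_upto (primes_in 0 z) h)) \<le>
     C * real h * exp (- (ln y / ln z * ln (real h))) * ln z * exp (3 * y)"
    using card_smooth_le by blast
  define zz where "zz x = exp (ln x * ln (ln (ln x)) / (b * ln (ln x)))" for x
  define uu where "uu x = c * x * ln x * ln (ln (ln x)) / ln (ln x)" for x
  define yy where "yy x = ln (ln x) / ln (ln (ln x))" for x :: real
  define EE where "EE x = exp (x * ln (ln x))" for x :: real
  define RR where "RR x = ln x / ln (zz x) * exp (13 / ln (zz x) + 2 / zz x) / (x * ln (ln x) / 2 - 5 * ln x)" for x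
  have "eventually (\<lambda>x. (uu x * uu x + uu x * (x ^ 4 + 1)) / EE x +
      uu x * (ln (ln (uu x)) - ln (ln x) + 13 / ln x + 2 / zz x +
        C * exp (- (ln (yy x) / ln (zz x) * ln x)) * ln (zz x) * exp (3 * yy x)) *
      (1 + 1 / x + (1 + uu x) / EE x) *
      (((x * ln (ln x) + x * ln 4 + ln 4) / ln 2) / x ^ 4 + pi\<^sup>2 / 6 * RR x +
       (x ^ 4 + 1) * (RR x + 2 * (EE x / x ^ 8)) / (EE x / x)) < 1) at_top"
    using main_inequality_eventually[OF bc, of C]
    unfolding zz_def uu_def yy_def EE_def RR_def .
  moreover have "eventually (\<lambda>x::real. x \<ge> 3) at_top" by (rule eventually_ge_at_top)
  moreover have "eventually (\<lambda>x. zz x \<ge> 2) at_top" unfolding zz_def using bc by real_asymp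
  moreover have "eventually (\<lambda>x. zz x \<le> x) at_top" unfolding zz_def using bc by real_asymp
  moreover have "eventually (\<lambda>x. uu x \<ge> x + 1) at_top" unfolding uu_def using bc by real_asymp
  moreover have "eventually (\<lambda>x. yy x \<ge> 1) at_top" unfolding yy_def by real_asymp
  moreover have "eventually (\<lambda>x. 4 * ln (yy x) \<le> ln (zz x)) at_top"
    unfolding yy_def zz_def using bc by real_asymp
  moreover have "eventually (\<lambda>x::real. exp (x * ln (ln x) / 2) / x ^ 4 \<ge> 3) at_top" by real_asymp
  moreover have "eventually (\<lambda>x::real. exp (x * ln (ln x) / 2) / x ^ 5 \<le> exp (x * ln (ln x) / 2) / x ^ 4 - 1) at_top"
    by real_asymp
  moreover have "eventually (\<lambda>x::real. x * ln (ln x) / 2 - 5 * ln x > 0) at_top" by real_asymp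
  moreover have "eventually (\<lambda>x. 1 + 1 / x + (1 + uu x) / EE x \<le> 2) at_top"
    unfolding uu_def EE_def using bc by real_asymp
  moreover have "eventually (\<lambda>x::real. EE x / x \<ge> 1) at_top" unfolding EE_def by real_asymp
  ultimately show ?thesis
  proof eventually_elim
    case (elim x)
    define z u y E R where defs: "z = zz x" "u = uu x" "y = yy x" "E = EE x" "R = RR x"
    define L where "L = x * ln (ln x)"
    \<comment> \<open>V will be at most v A Q: 1/x is the relative length of the range of k, 1/E its
      rounding, and u/E the contribution of h.\<close>
    define v where "v = 1 + 1 / x + (1 + u) / E"
    define l where "l = (L + x * ln 4 + ln 4) / ln 2"
    define T where "T = u * (ln (ln u) - ln (ln x) + 13 / ln x + 2 / z +
        C * exp (- (ln y / ln z * ln x)) * ln z * exp (3 * y))"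
    note main = elim(1)[folded defs, folded L_def, folded l_def v_def T_def]
    note ev = elim(2-12)[folded defs, folded L_def, folded v_def]
    have x: "x \<ge> 3" and z: "z \<ge> 2" "z \<le> x" and u: "u \<ge> x + 1" and y: "y \<ge> 1" "4 * ln y \<le> ln z"
      and v2: "v \<le> 2" and Lx: "L / 2 - 5 * ln x > 0" and Ex: "E / x \<ge> 1" using ev by auto
    have E: "E = exp L" by (simp add: defs(4) EE_def L_def)
    have E1: "E \<ge> 1" using Ex x by (simp add: field_simps)
    have ln2: "ln (2 :: real) > 0" by simp
    have ln4: "0 < ln (4 :: real)" "ln (4 :: real) \<le> 3 / 2"
      using ln2_le_25_over_36 ln_realpow[of 2 2] by auto
    have lx: "ln x > 0" "ln x \<ge> 1" "ln (ln x) \<ge> 0"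
    proof -
      show "ln x \<ge> 1" using x exp_le by (subst ln_ge_iff) auto
      then show "ln (ln x) \<ge> 0" by simp
    qed (use x in auto)

    \<comment> \<open>With H near E/x, all k Q agree with A Q up to a factor 1 + o(1). M near x^4
      makes log V / M negligible against R, and Z near sqrt(E)/x^4 brings M Z^2 / H down to order
      x^(-3), while ln Z is half of ln E up to O(ln x).\<close>
    define h where "h = nat \<lfloor>u\<rfloor>"
    define A where "A = nat \<lceil>E\<rceil>"
    define H where "H = nat \<lceil>E / x\<rceil>"
    define M where "M = nat \<lceil>x ^ 4\<rceil>"
    define Z where "Z = nat \<lfloor>exp (L / 2) / x ^ 4\<rfloor>"
    define B where "B = primes_in z x"
    define Q where "Q = \<Prod>B"
    define V where "V = real ((A + H) * Q + h)"
    define R' where "R' = totient_ratio B / ln (real Z)"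
    have h: "real h \<le> u" "real h \<ge> x" "u \<le> real h + 1"
      using u x unfolding h_def by linarith+
    have A: "E \<le> real A" "real A \<le> 2 * E" using E1 unfolding A_def by linarith+
    have H: "E / x \<le> real H" "real H \<le> E / x + 1" using Ex unfolding H_def by linarith+
    have x4: "x ^ 4 \<ge> 1" using x by (intro one_le_power) simp
    have M: "x ^ 4 \<le> real M" "real M \<le> x ^ 4 + 1" using x4 unfolding M_def by linarith+
    have Z: "real Z \<le> exp (L / 2) / x ^ 4" "real Z \<ge> exp (L / 2) / x ^ 5" "real Z \<ge> 2"
      using ev(7,8) unfolding Z_def by linarith+
    have lnZ: "ln (real Z) \<ge> L / 2 - 5 * ln x"
    proof -
      have "L / 2 - 5 * ln x = ln (exp (L / 2) / x ^ 5)" using x by (simp add: ln_div ln_realpow)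
      also have "\<dots> \<le> ln (real Z)" using Z x by (subst ln_le_cancel_iff) auto
      finally show ?thesis .
    qed
    have Z2: "(real Z)\<^sup>2 \<le> E / x ^ 8"
    proof -
      have "(real Z)\<^sup>2 \<le> (exp (L / 2) / x ^ 4)\<^sup>2" using Z(1) by (intro power_mono) auto
      also have "\<dots> = E / x ^ 8"
        by (simp add: E power_divide exp_double [symmetric] flip: power_mult)
      finally show ?thesis .
    qed
    have B: "finite B" "\<And>p. p \<in> B \<Longrightarrow> prime p" by (simp_all add: B_def) (simp add: primes_in_def)
    have Q: "Q > 0" unfolding Q_def using B(2) by (intro prod_pos) (auto simp: prime_gt_0_nat)
    then have Q1: "real Q \<ge> 1" by linarith
    have Qle: "real Q \<le> exp (x * ln 4)"
      unfolding Q_def B_def using x z by (intro prod_primes_in_le) auto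
    have AQ: "E \<le> real A * real Q" using A Q1 E1 mult_mono[of E "real A" 1 "real Q"] by simp
    have V: "V \<le> v * (real A * real Q)"
    proof -
      have AE: "1 \<le> real A / E" using A E1 by simp
      have "real H \<le> real A / x + real A / E"
        using H(2) A(1) AE x divide_right_mono[of E "real A" x] by linarith
      then have 1: "real H * real Q \<le> (real A / x + real A / E) * real Q"
        by (intro mult_right_mono) auto
      have "1 \<le> real A * real Q / E" using AQ E1 by simp
      then have "u * 1 \<le> u * (real A * real Q / E)" using u x by (intro mult_left_mono) auto
      with h(1) have 2: "real h \<le> u * (real A * real Q / E)" by simp
      have "V = real A * real Q + real H * real Q + real h" by (simp add: V_def algebra_simps)
      also have "\<dots> \<le> real A * real Q + (real A / x + real A / E) * real Q + u * (real A * real Q / E)"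
        using 1 2 by linarith
      also have "\<dots> = v * (real A * real Q)"
        by (simp add: v_def add_divide_distrib algebra_simps)
      finally show ?thesis .
    qed
    have V1: "V \<ge> 1"
    proof -
      have "V = real A * real Q + real H * real Q + real h" by (simp add: V_def algebra_simps)
      moreover have "0 \<le> real H * real Q" by simp
      ultimately show ?thesis using AQ E1 by linarith
    qed
    have lnV: "ln V \<le> L + x * ln 4 + ln 4"
    proof -
      have "V \<le> v * (real A * real Q)" by (rule V)
      also have "\<dots> \<le> 2 * (real A * real Q)" using v2 by (intro mult_right_mono) auto
      also have "\<dots> \<le> 2 * (2 * E * exp (x * ln 4))"
        using A Qle E1 by (intro mult_left_mono mult_mono) auto
      also have "\<dots> = exp (L + x * ln 4 + ln 4)" by (simp add: exp_add E)
      finally have "ln V \<le> ln (exp (L + x * ln 4 + ln 4))"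
        using V1 by (subst ln_le_cancel_iff) auto
      then show ?thesis by simp
    qed
    have T: "(\<Sum>t=1..h. 1 / real (gcd t Q)) \<le> T"
    proof -
      have "(\<Sum>t=1..h. 1 / real (gcd t Q)) \<le>
          real h * (ln (ln (real h)) - ln (ln x) + 13 / ln x) + 2 * real h / z +
          real (card (smooth_upto (primes_in 0 z) h))"
        unfolding Q_def B_def using z h by (intro sum_inverse_gcd_le)
      also have "real h * (ln (ln (real h)) - ln (ln x) + 13 / ln x) \<le>
          u * (ln (ln u) - ln (ln x) + 13 / ln x)"
      proof (intro mult_mono)
        have "ln x \<le> ln (real h)" "ln (real h) \<le> ln u" using h x u by auto
        then have "ln (ln x) \<le> ln (ln (real h))" "ln (ln (real h)) \<le> ln (ln u)"
          using lx by auto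
        then show "ln (ln (real h)) - ln (ln x) + 13 / ln x \<le> ln (ln u) - ln (ln x) + 13 / ln x"
          "0 \<le> ln (ln (real h)) - ln (ln x) + 13 / ln x" using lx by auto
      qed (use h u x in auto)
      also have "2 * real h / z \<le> u * (2 / z)" using h z by (simp add: divide_right_mono)
      also have "real (card (smooth_upto (primes_in 0 z) h)) \<le>
          C * real h * exp (- (ln y / ln z * ln (real h))) * ln z * exp (3 * y)"
        using z y h x by (intro C(2)) auto
      also have "\<dots> \<le> C * u * exp (- (ln y / ln z * ln x)) * ln z * exp (3 * y)"
      proof -
        have "ln y / ln z * ln x \<le> ln y / ln z * ln (real h)"
          using y z h x by (intro mult_left_mono) auto
        then show ?thesis
          using C(1) h u x z by (intro mult_right_mono mult_mono) auto
      qed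
      also have "u * (ln (ln u) - ln (ln x) + 13 / ln x) + u * (2 / z) +
          C * u * exp (- (ln y / ln z * ln x)) * ln z * exp (3 * y) = T"
        by (simp add: T_def algebra_simps)
      finally show ?thesis by simp
    qed
    have T0: "0 \<le> (\<Sum>t=1..h. 1 / real (gcd t Q))" by (intro sum_nonneg) auto
    have R': "R' \<le> R" "R' \<ge> 0"
    proof -
      have "totient_ratio B \<le> ln x / ln z * exp (13 / ln z + 2 / z)"
        unfolding B_def using z by (intro totient_ratio_primes_in_le)
      moreover have tr: "totient_ratio B > 0" using B(2) by (rule totient_ratio_pos)
      ultimately have "R' \<le> ln x / ln z * exp (13 / ln z + 2 / z) / (L / 2 - 5 * ln x)"
        unfolding R'_def using lnZ Lx by (intro frac_le) auto
      then show "R' \<le> R" by (simp add: defs(5) RR_def L_def defs(1))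
      show "R' \<ge> 0" unfolding R'_def using tr Z(3) by simp
    qed
    have logV: "log 2 V / real M \<le> l / x ^ 4"
    proof (intro frac_le)
      show "log 2 V \<le> l" using lnV ln2 by (simp add: log_def l_def divide_right_mono)
      show "0 \<le> l" using lx x ln4 by (simp add: l_def L_def)
    qed (use M x in auto)
    have last: "real M * (R' + 2 * (real Z)\<^sup>2) / real H \<le> (x ^ 4 + 1) * (R + 2 * (E / x ^ 8)) / (E / x)"
    proof (intro frac_le mult_mono)
      show "R' + 2 * (real Z)\<^sup>2 \<le> R + 2 * (E / x ^ 8)" using R' Z2 by simp
      show "0 < E / x" using Ex by simp
      show "E / x \<le> real H" by (rule H(1))
      show "real M \<le> x ^ 4 + 1" by (rule M(2))
      show "0 \<le> R' + 2 * (real Z)\<^sup>2" using R' by simp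
      have "0 \<le> R + 2 * (E / x ^ 8)" using R' E1 x by simp
      then show "0 \<le> (x ^ 4 + 1) * (R + 2 * (E / x ^ 8))" using x4 by simp
      show "0 \<le> x ^ 4 + 1" using x4 by simp
    qed
    define G where "G = log 2 V / real M + pi\<^sup>2 / 6 * R' + real M * (R' + 2 * (real Z)\<^sup>2) / real H"
    define G' where "G' = l / x ^ 4 + pi\<^sup>2 / 6 * R + (x ^ 4 + 1) * (R + 2 * (E / x ^ 8)) / (E / x)"
    have G: "0 \<le> G" "G \<le> G'"
    proof -
      show "G \<le> G'" unfolding G_def G'_def using R' logV last by (intro add_mono mult_left_mono) auto
      have "0 \<le> log 2 V" using V1 by simp
      then show "0 \<le> G" unfolding G_def using R' by simp
    qed
    have "real h * real h + real h * real M + (\<Sum>t=1..h. 1 / real (gcd t Q)) * V * G \<le>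
        (u * u + u * (x ^ 4 + 1)) + T * (v * (real A * real Q)) * G'"
      using h u x M V V1 T T0 G by (intro add_mono mult_mono) auto
    also have "\<dots> \<le> (u * u + u * (x ^ 4 + 1)) / E * (real A * real Q) + T * (v * (real A * real Q)) * G'"
    proof -
      have "(u * u + u * (x ^ 4 + 1)) * 1 \<le> (u * u + u * (x ^ 4 + 1)) * (real A * real Q / E)"
        using AQ E1 u x x4 by (intro mult_left_mono) auto
      then show ?thesis by simp
    qed
    also have "\<dots> = ((u * u + u * (x ^ 4 + 1)) / E + T * v * G') * (real A * real Q)"
      by (simp add: algebra_simps)
    also have "\<dots> < 1 * (real A * real Q)"
      using main AQ E1 unfolding G'_def by (intro mult_strict_right_mono) auto
    finally have small: "real h * real h + real h * real M + (\<Sum>t=1..h. 1 / real (gcd t Q)) * V * G <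
        real A * real Q" by simp
    have "\<exists>k\<in>{A..<A + H}. f (k * Q) > h"
      unfolding Q_def
    proof (rule ex_multiple_f_gt[where M = M and Z = Z and V = V])
      show "h \<ge> 1" "A \<ge> 1" "H \<ge> 1" "M \<ge> 1" "Z \<ge> 2" using h(2) x A E1 H Ex M x4 Z(3) by linarith+
      show "real h * real h + real h * real M + (\<Sum>t = 1..h. 1 / real (gcd t (\<Prod>B))) * V *
        (log 2 V / real M + pi\<^sup>2 / 6 * (totient_ratio B / ln (real Z)) +
         real M * (totient_ratio B / ln (real Z) + 2 * (real Z)\<^sup>2) / real H) < real A * real (\<Prod>B)"
        using small unfolding G_def R'_def Q_def .
    qed (use B in \<open>auto simp: V_def Q_def\<close>)
    then obtain k where k: "A \<le> k" "k < A + H" "f (k * Q) > h" by auto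
    show ?case
    proof (intro exI[of _ "k * Q"] conjI)
      have k0: "real k \<ge> E" using k(1) A(1) by linarith
      then have kQ: "real (k * Q) \<ge> E" using Q1 E1 mult_mono[of E "real k" 1 "real Q"] by simp
      then show pos: "k * Q > 0" using E1 by (cases "k * Q") auto
      have "L = ln E" by (simp add: E)
      also have "\<dots> \<le> ln (real (k * Q))" using kQ E1 pos by (subst ln_le_cancel_iff) auto
      finally show "x * ln (ln x) \<le> ln (real (k * Q))" by (simp add: L_def)
      have "k * Q \<le> (A + H) * Q" using k(2) by (intro mult_le_mono1) simp
      then have "k * Q \<le> (A + H) * Q + h" by (rule trans_le_add1)
      then have "real (k * Q) \<le> V" unfolding V_def by (rule of_nat_mono)
      then have "ln (real (k * Q)) \<le> ln V" using pos V1 by (subst ln_le_cancel_iff) auto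
      also have "\<dots> \<le> L + x * ln 4 + ln 4" by (rule lnV)
      also have "\<dots> \<le> L + x * (3 / 2) + 3 / 2" using ln4 x by (intro add_mono mult_left_mono) auto
      also have "\<dots> \<le> L + 3 * x" using x by simp
      finally show "ln (real (k * Q)) \<le> x * ln (ln x) + 3 * x" by (simp add: L_def)
      have "u \<le> real (f (k * Q))" using h(3) k(3) by linarith
      then show "c * x * ln x * ln (ln (ln x)) / ln (ln x) \<le> real (f (k * Q))"
        by (simp add: defs(2) uu_def)
    qed
  qed
qed

text \<open>To pass from x to n, ln n and its iterates in the numerator are replaced by those of the
  upper bound x ln (ln x) + 3 x, and log_3 n in the denominator by its lower bound ln (ln x). The
  result has ratio d/c < 1 to the bound for f in the limit, which is what \<open>ev1\<close>
  exploits.\<close>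

theorem proposition1p2:
  fixes \<epsilon> :: real
  assumes "\<epsilon> > 0"
  shows "infinite {n::nat. n > 0 \<and> (\<forall>j\<in>{1..4}. iter_log j (real n) > 0) \<and>
    real (f n) \<ge> (3 / (2 * pi\<^sup>2) - \<epsilon>) * iter_log 1 (real n) *
      ((iter_log 2 (real n) * iter_log 4 (real n)) / (iter_log 3 (real n))\<^sup>2)}"
proof -
  \<comment> \<open>The maximum keeps the coefficient positive for large \<epsilon>; 1 / pi^2 serves
    as a positive number below 3 / (2 pi^2). The strict inequality leaves room for c, and c < 3 / (2
    pi^2) in turn leaves room for b > 2.\<close>
  define d where "d = max (3 / (2 * pi\<^sup>2) - \<epsilon>) (1 / pi\<^sup>2)"
  have d: "0 < d" "3 / (2 * pi\<^sup>2) - \<epsilon> \<le> d" "d < 3 / (2 * pi\<^sup>2)"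
    using assms by (auto simp: d_def less_max_iff_disj field_simps)
  obtain c where c: "d < c" "c < 3 / (2 * pi\<^sup>2)" using dense[OF d(3)] by blast
  have c0: "c > 0" using c d by simp
  have "2 < 3 / (c * pi\<^sup>2)" using c c0 by (simp add: field_simps)
  then obtain b where b: "2 < b" "b < 3 / (c * pi\<^sup>2)" using dense by blast
  have cb: "c * b * pi\<^sup>2 < 3" using b c0 by (simp add: field_simps)
  have ev1: "eventually (\<lambda>x::real. d * (x * ln (ln x) + 3 * x) * ln (x * ln (ln x) + 3 * x) *
      ln (ln (ln (x * ln (ln x) + 3 * x))) / (ln (ln x))\<^sup>2 \<le> c * x * ln x * ln (ln (ln x)) / ln (ln x)) at_top"
    using c(1) d(1) by real_asymp
  have ev2: "eventually (\<lambda>x::real. x * ln (ln x) \<ge> x \<and> ln (ln (ln x)) > 0 \<and> ln (ln x) > 0 \<and> ln x > 0 \<and> x > 0) at_top"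
    by (intro eventually_conj) real_asymp+
  show ?thesis
    unfolding infinite_nat_iff_unbounded
  proof
    fix N :: nat
    \<comment> \<open>Since ln n >= x ln (ln x) >= x, this forces n > N.\<close>
    have "eventually (\<lambda>x::real. x > ln (real N + 1)) at_top" by (rule eventually_gt_at_top)
    from eventually_happens[OF eventually_conj[OF eventually_ex_large_f[OF c0 b(1) cb]
        eventually_conj[OF ev1 eventually_conj[OF ev2 this]]]]
    obtain x n where n: "n > 0" "x * ln (ln x) \<le> ln (real n)" "ln (real n) \<le> x * ln (ln x) + 3 * x"
        "c * x * ln x * ln (ln (ln x)) / ln (ln x) \<le> real (f n)"
      and x: "d * (x * ln (ln x) + 3 * x) * ln (x * ln (ln x) + 3 * x) *
        ln (ln (ln (x * ln (ln x) + 3 * x))) / (ln (ln x))\<^sup>2 \<le> c * x * ln x * ln (ln (ln x)) / ln (ln x)"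
        "x * ln (ln x) \<ge> x" "ln (ln (ln x)) > 0" "ln (ln x) > 0" "ln x > 0" "x > 0" "ln (real N + 1) < x"
      by auto
    define l1 where "l1 = ln (real n)"
    define U where "U = x * ln (ln x) + 3 * x"
    have l1: "x \<le> l1" "l1 \<le> U"
      using order_trans[OF x(2) n(2)] n(3) by (simp_all add: l1_def U_def)
    have l2: "ln x \<le> ln l1" "ln l1 \<le> ln U" using l1 x by auto
    have l3: "ln (ln x) \<le> ln (ln l1)" "ln (ln l1) \<le> ln (ln U)" using l2 x by auto
    have l4: "ln (ln (ln x)) \<le> ln (ln (ln l1))" "ln (ln (ln l1)) \<le> ln (ln (ln U))" using l3 x by auto
    have il: "iter_log 1 (real n) = l1" "iter_log 2 (real n) = ln l1"
      "iter_log 3 (real n) = ln (ln l1)" "iter_log 4 (real n) = ln (ln (ln l1))"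
      by (simp_all add: iter_log_def l1_def eval_nat_numeral)
    have gt: "iter_log 1 (real n) > 0" "iter_log 2 (real n) > 0"
      "iter_log 3 (real n) > 0" "iter_log 4 (real n) > 0"
      unfolding il using l1(1) l2(1) l3(1) l4(1) x(3-6) by linarith+
    have pos: "\<forall>j\<in>{1..4}. iter_log j (real n) > 0"
    proof
      fix j :: nat assume "j \<in> {1..4}"
      then consider "j = 1" | "j = 2" | "j = 3" | "j = 4" by fastforce
      then show "iter_log j (real n) > 0"
        by cases (use gt in simp_all)
    qed
    have "(3 / (2 * pi\<^sup>2) - \<epsilon>) * (l1 * (ln l1 * ln (ln (ln l1)) / (ln (ln l1))\<^sup>2)) \<le>
        d * (U * (ln U * ln (ln (ln U)) / (ln (ln x))\<^sup>2))"
    proof -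
      have "e * (r * (r2 * r4 / r3\<^sup>2)) \<le> d * (s * (s2 * s4 / s3\<^sup>2))"
        if "e \<le> d" "0 \<le> r" "r \<le> s" "0 \<le> r2" "r2 \<le> s2" "0 \<le> r4" "r4 \<le> s4" "0 < s3" "s3 \<le> r3"
        for e r r2 r3 r4 s s2 s3 s4 :: real
        using that d(1) by (intro mult_mono frac_le power_mono mult_nonneg_nonneg divide_nonneg_nonneg) auto
      from this[OF d(2), of l1 U "ln l1" "ln U" "ln (ln (ln l1))" "ln (ln (ln U))" "ln (ln x)" "ln (ln l1)"]
      show ?thesis using gt[unfolded il] l1(2) l2(2) l3(1) l4(2) x(4) by linarith
    qed
    also have "\<dots> \<le> real (f n)" using x(1) n(4) by (simp add: U_def mult_ac)
    finally have "real (f n) \<ge> (3 / (2 * pi\<^sup>2) - \<epsilon>) * iter_log 1 (real n) *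
      ((iter_log 2 (real n) * iter_log 4 (real n)) / (iter_log 3 (real n))\<^sup>2)"
      by (simp only: il mult.assoc)
    moreover have "n > N"
    proof -
      have "ln (real N + 1) < ln (real n)" using x(7) l1(1) by (simp add: l1_def)
      then have "real N + 1 < real n" using n(1) by (subst (asm) ln_less_cancel_iff) auto
      then show ?thesis by simp
    qed
    ultimately show "\<exists>n>N. n \<in> {n::nat. n > 0 \<and> (\<forall>j\<in>{1..4}. iter_log j (real n) > 0) \<and>
      real (f n) \<ge> (3 / (2 * pi\<^sup>2) - \<epsilon>) * iter_log 1 (real n) *
      ((iter_log 2 (real n) * iter_log 4 (real n)) / (iter_log 3 (real n))\<^sup>2)}"
      using n(1) pos by blast
  qed
qed

end
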